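(* Let $f\in\mathcal S'(\mathbb{R}^n)$ be of $\mathcal S'$-order $d\ge0$ and let $\Phi\in\mathcal S(\mathbb{R}^n)$. For each integer $m\ge-1$ let $$P_m(x)=\sum_{|\alpha|\le m}\partial^\alpha\big(t^n\Phi(t\cdot)*f\big)(0)\frac{x^\alpha}{\alpha!}$$ be the Taylor polynomial of degree $m$ at $x=0$ of the $C^\infty$-function $t^n\Phi(t\cdot)*f$, $t>0$, and define $R_m$ by $t^n\Phi(t\cdot)*f=P_m+R_m$. Then, for $t\to0^+$, the term of $P_m$ with index $\alpha$ is $\mathcal O(t^{n+|\alpha|-d})$ in $\mathcal S'$-seminorm, whilst the remainder similarly satisfies $$R_m=\mathcal O(t^{n+m+1-d}).$$ Moreover, any polynomial $Q(x)=\sum_{|\alpha|\le m(t)}c_\alpha(t)x^\alpha$ (with $t$-dependent degree $m(t)$ and coefficients) such that $t^n\Phi(t\cdot)*f=Q+R$ with a remainder $R=o(1)$ in $\mathcal S'$-seminorm for $t\to0^+$ is given by $$c_\alpha(t)=\frac1{\alpha!}\partial^\alpha\big(t^n\Phi(t\cdot)*f\big)(0)+o(1),$$ where $c_\alpha(t)=o(1)$ for $t\to0^+$ when $|\alpha|>d-n$.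
   Context: $\mathcal S$, $\mathcal S'$ are the Schwartz functions and tempered distributions on $\mathbb{R}^n$. $f\in\mathcal S'$ has $\mathcal S'$-order (temperate order) $d$ if $d\ge0$ is the smallest integer such that, for some $c$, $|\langle f,\psi\rangle|\le c\,p_d(\psi)$ for all $\psi\in\mathcal S$, where $p_d(\psi)=\sup_{|\alpha|\le d}\|(1+|x|)^dD^\alpha\psi\|_\infty$ and $D^\alpha=(-i)^{|\alpha|}\partial^\alpha$. A $t$-dependent tempered distribution $u_t$ is $\mathcal O(t^{r})$ (respectively $o(1)$) in $\mathcal S'$-seminorm for $t\to0^+$ if for every $\psi\in\mathcal S$ one has $\langle u_t,\psi\rangle=\mathcal O(t^r)$ (respectively $o(1)$) for $t\to0^+$. For $m=-1$ one sets $P_{-1}=0$. Coefficients $c_\alpha(t)$ with $|\alpha|>m(t)$ are understood as $0$. *)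

theory Defs
  imports "HOL-Analysis.Analysis" "HOL-Library.Landau_Symbols"
begin

section \<open>Multi-indices and partial derivatives on \<open>real ^ 'n\<close>\<close>

definition mi_size :: "('n::finite \<Rightarrow> nat) \<Rightarrow> nat" where
  "mi_size \<alpha> = (\<Sum>i\<in>UNIV. \<alpha> i)"

definition mi_fact :: "('n::finite \<Rightarrow> nat) \<Rightarrow> real" where
  "mi_fact \<alpha> = (\<Prod>i\<in>UNIV. fact (\<alpha> i))"

definition mi_power :: "real ^ 'n \<Rightarrow> ('n::finite \<Rightarrow> nat) \<Rightarrow> real" where
  "mi_power x \<alpha> = (\<Prod>i\<in>UNIV. (x $ i) ^ \<alpha> i)"

text \<open>The bound is an integer so that the set is empty for the bound \<open>-1\<close>.\<close>

definition mi_upto :: "int \<Rightarrow> ('n::finite \<Rightarrow> nat) set" where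
  "mi_upto m = {\<alpha>. int (mi_size \<alpha>) \<le> m}"

lemma finite_mi_upto: "finite (mi_upto m :: ('n::finite \<Rightarrow> nat) set)"
proof -
  have "\<alpha> i \<in> {..nat m}" if "\<alpha> \<in> mi_upto m" for \<alpha> :: "'n \<Rightarrow> nat" and i
    using that member_le_sum[of i UNIV \<alpha>]
    by (simp add: mi_upto_def mi_size_def le_nat_iff flip: of_nat_sum)
  hence "mi_upto m \<subseteq> (PiE UNIV (\<lambda>_. {..nat m}) :: ('n \<Rightarrow> nat) set)"
    by (auto simp: PiE_UNIV_domain)
  thus ?thesis
    by (rule finite_subset) (intro finite_PiE, auto)
qed

definition partial :: "'n::finite \<Rightarrow> (real ^ 'n \<Rightarrow> complex) \<Rightarrow> real ^ 'n \<Rightarrow> complex" where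
  "partial i f x = vector_derivative (\<lambda>s. f (x + s *\<^sub>R axis i 1)) (at 0)"

text \<open>Mixed derivatives are taken in a fixed order of the coordinates; for smooth functions the
  order is irrelevant.\<close>

definition coords :: "'n::finite list" where
  "coords = (SOME is. distinct is \<and> set is = UNIV)"

definition mi_partial ::
    "('n::finite \<Rightarrow> nat) \<Rightarrow> (real ^ 'n \<Rightarrow> complex) \<Rightarrow> real ^ 'n \<Rightarrow> complex" where
  "mi_partial \<alpha> f = foldr (\<lambda>i g. (partial i ^^ \<alpha> i) g) coords f"

definition mi_D ::
    "('n::finite \<Rightarrow> nat) \<Rightarrow> (real ^ 'n \<Rightarrow> complex) \<Rightarrow> real ^ 'n \<Rightarrow> complex" where
  "mi_D \<alpha> f x = (- \<i>) ^ mi_size \<alpha> * mi_partial \<alpha> f x"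

primrec C_k :: "nat \<Rightarrow> (real ^ 'n::finite \<Rightarrow> complex) \<Rightarrow> bool" where
  "C_k 0 f \<longleftrightarrow> continuous_on UNIV f"
| "C_k (Suc k) f \<longleftrightarrow> f differentiable_on UNIV \<and> (\<forall>i. C_k k (partial i f))"

definition smooth :: "(real ^ 'n::finite \<Rightarrow> complex) \<Rightarrow> bool" where
  "smooth f \<longleftrightarrow> (\<forall>k. C_k k f)"

section \<open>Schwartz functions and tempered distributions\<close>

definition schwartz :: "(real ^ 'n::finite \<Rightarrow> complex) set" where
  "schwartz = {\<psi>. smooth \<psi> \<and>
     (\<forall>N \<alpha>. bounded (range (\<lambda>x. (1 + norm x) ^ N *\<^sub>R mi_partial \<alpha> \<psi> x)))}"

text \<open>On \<open>schwartz\<close> all suprema below are finite.\<close>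

definition schwartz_seminorm :: "nat \<Rightarrow> (real ^ 'n::finite \<Rightarrow> complex) \<Rightarrow> real" where
  "schwartz_seminorm d \<psi> =
     (SUP \<alpha>\<in>mi_upto (int d). SUP x. norm ((1 + norm x) ^ d *\<^sub>R mi_D \<alpha> \<psi> x))"

definition seminorm_bounded ::
    "((real ^ 'n::finite \<Rightarrow> complex) \<Rightarrow> complex) \<Rightarrow> nat \<Rightarrow> bool" where
  "seminorm_bounded u d \<longleftrightarrow> (\<exists>c. \<forall>\<psi>\<in>schwartz. norm (u \<psi>) \<le> c * schwartz_seminorm d \<psi>)"

text \<open>A distribution is a functional on all functions, of which only the restriction to
  \<open>schwartz\<close> matters; the pairing is bilinear. The seminorms are increasing in \<open>d\<close> and
  define the topology, so continuity means boundedness by one of them.\<close>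

definition tempered_distribution ::
    "((real ^ 'n::finite \<Rightarrow> complex) \<Rightarrow> complex) \<Rightarrow> bool" where
  "tempered_distribution u \<longleftrightarrow>
     (\<forall>\<phi>\<in>schwartz. \<forall>\<psi>\<in>schwartz. \<forall>a b. u (\<lambda>x. a * \<phi> x + b * \<psi> x) = a * u \<phi> + b * u \<psi>) \<and>
     (\<exists>d. seminorm_bounded u d)"

definition has_temperate_order ::
    "((real ^ 'n::finite \<Rightarrow> complex) \<Rightarrow> complex) \<Rightarrow> nat \<Rightarrow> bool" where
  "has_temperate_order u d \<longleftrightarrow> seminorm_bounded u d \<and> (\<forall>k. seminorm_bounded u k \<longrightarrow> d \<le> k)"

definition convolution ::
    "(real ^ 'n::finite \<Rightarrow> complex) \<Rightarrow> ((real ^ 'n \<Rightarrow> complex) \<Rightarrow> complex) \<Rightarrow>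
     real ^ 'n \<Rightarrow> complex" where
  "convolution \<phi> u x = u (\<lambda>y. \<phi> (x - y))"

definition dilation ::
    "(real ^ 'n::finite \<Rightarrow> complex) \<Rightarrow> real \<Rightarrow> real ^ 'n \<Rightarrow> complex" where
  "dilation \<Phi> t x = of_real (t ^ CARD('n)) * \<Phi> (t *\<^sub>R x)"

section \<open>Asymptotics in the seminorms of tempered distributions\<close>

definition distribution_bigo ::
    "(real \<Rightarrow> (real ^ 'n::finite \<Rightarrow> complex) \<Rightarrow> complex) \<Rightarrow> real \<Rightarrow> bool" where
  "distribution_bigo u r \<longleftrightarrow>
     (\<forall>t>0. tempered_distribution (u t)) \<and>
     (\<forall>\<psi>\<in>schwartz. (\<lambda>t. norm (u t \<psi>)) \<in> O[at_right 0](\<lambda>t. t powr r))"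

definition distribution_smallo_1 ::
    "(real \<Rightarrow> (real ^ 'n::finite \<Rightarrow> complex) \<Rightarrow> complex) \<Rightarrow> bool" where
  "distribution_smallo_1 u \<longleftrightarrow>
     (\<forall>t>0. tempered_distribution (u t)) \<and>
     (\<forall>\<psi>\<in>schwartz. (\<lambda>t. u t \<psi>) \<in> o[at_right 0](\<lambda>_. 1))"

definition fun_distribution ::
    "(real ^ 'n::finite \<Rightarrow> complex) \<Rightarrow> (real ^ 'n \<Rightarrow> complex) \<Rightarrow> complex" where
  "fun_distribution g \<psi> = (LINT x|lborel. g x * \<psi> x)"

text \<open>Functions are read as distributions through \<open>fun_distribution\<close>. Requiring integrability
  rules out that the pairing is the default value \<open>0\<close> of an undefined integral.\<close>

definition pairs_with_schwartz :: "(real ^ 'n::finite \<Rightarrow> complex) \<Rightarrow> bool" where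
  "pairs_with_schwartz g \<longleftrightarrow> (\<forall>\<psi>\<in>schwartz. integrable lborel (\<lambda>x. g x * \<psi> x))"

definition seminorm_bigo :: "(real \<Rightarrow> real ^ 'n::finite \<Rightarrow> complex) \<Rightarrow> real \<Rightarrow> bool" where
  "seminorm_bigo g r \<longleftrightarrow>
     (\<forall>t>0. pairs_with_schwartz (g t)) \<and> distribution_bigo (\<lambda>t. fun_distribution (g t)) r"

definition seminorm_smallo_1 :: "(real \<Rightarrow> real ^ 'n::finite \<Rightarrow> complex) \<Rightarrow> bool" where
  "seminorm_smallo_1 g \<longleftrightarrow>
     (\<forall>t>0. pairs_with_schwartz (g t)) \<and> distribution_smallo_1 (\<lambda>t. fun_distribution (g t))"

section \<open>Taylor polynomials at the origin\<close>

definition taylor_term ::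
    "(real ^ 'n::finite \<Rightarrow> complex) \<Rightarrow> ('n \<Rightarrow> nat) \<Rightarrow> real ^ 'n \<Rightarrow> complex" where
  "taylor_term g \<alpha> x = mi_partial \<alpha> g 0 * of_real (mi_power x \<alpha> / mi_fact \<alpha>)"

definition taylor_poly ::
    "(real ^ 'n::finite \<Rightarrow> complex) \<Rightarrow> int \<Rightarrow> real ^ 'n \<Rightarrow> complex" where
  "taylor_poly g m x = (\<Sum>\<alpha>\<in>mi_upto m. taylor_term g \<alpha> x)"

definition taylor_remainder ::
    "(real ^ 'n::finite \<Rightarrow> complex) \<Rightarrow> int \<Rightarrow> real ^ 'n \<Rightarrow> complex" where
  "taylor_remainder g m x = g x - taylor_poly g m x"

end

theory Submission
  imports "HOL-Probability.Characteristic_Functions" "HOL-Probability.Sinc_Integral" Defs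
begin

text \<open>
  Convolution with a tempered distribution \<open>u\<close> of order \<open>d\<close> satisfies
  \<open>\<bar>(\<phi> * u)(x)\<bar> \<le> c (1 + \<bar>x\<bar>)^d p_d(\<phi>)\<close> and commutes with partial derivatives, so the derivatives of
  order \<open>k\<close> of \<open>t^n \<Phi>(t \<cdot>) * f\<close> are bounded by \<open>C t^(n + k - d) (1 + \<bar>x\<bar>)^d\<close> for \<open>0 < t \<le> 1\<close>.
  Together with Taylor's formula this gives the estimates of the terms and of the remainder.

  For the uniqueness of the coefficients the degree \<open>m(t)\<close> may be unbounded as \<open>t \<rightarrow> 0\<close>, so one tests
  against a Schwartz function \<open>\<psi>\<close> with \<open>\<integral> x^\<beta> \<psi>(x) dx = \<delta>_(\<alpha>\<beta>)\<close> for \<^emph>\<open>all\<close> \<open>\<beta>\<close>. In one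
  dimension such a function, supported on the half-line, is \<open>x^(-k-1) F(ln x)\<close> with
  \<open>F'(u) = exp(-u^2/2) sin(2 \<pi> u)\<close>: since the sine is 1-periodic, \<open>\<integral> exp(j u) F'(u) du = 0\<close> for
  every integer \<open>j\<close>, and integration by parts gives \<open>\<integral> exp(j u) F(u) du = 0\<close> for \<open>j \<noteq> 0\<close>,
  whereas \<open>\<integral> F \<noteq> 0\<close>.
\<close>

section \<open>Iterated partial derivatives\<close>

text \<open>The exponent \<open>n + k - d\<close> is a matter of scaling: the normalisation gives
  t^n, each of the k derivatives gives t, and comparing 1 + |x| with 1 + |t x| costs 1/t for each of
  the d powers of the weight. If the degree m(t) were bounded, only finitely many moments of the
  test function would have to vanish. With unbounded degree no compactly supported function serves:
  its Fourier transform is entire, the moments would force it to be a monomial, and a monomial does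
  not decay. The construction therefore rests on an indeterminate moment problem; the log-normal
  weight with the factor sin(2 pi ln x) is Stieltjes' classical example, all of whose moments
  vanish. Passing to a primitive in the variable u = ln x divides the transform at j by -j, so the
  value at j = 0 alone escapes and becomes the single nonzero moment.\<close>

lemma vec_eq_sum_axis: "(h :: real ^ 'n::finite) = (\<Sum>i\<in>UNIV. (h $ i) *\<^sub>R axis i 1)"
  by (simp add: vec_eq_iff axis_def if_distrib[of "\<lambda>x. _ * x"] sum.delta cong: if_cong)

lemma partial_eqI:
  fixes f :: "real ^ 'n::finite \<Rightarrow> complex"
  assumes "(f has_derivative f') (at x)"
  shows "partial i f x = f' (axis i 1)"
proof -
  have "(f \<circ> (\<lambda>s. x + s *\<^sub>R axis i 1) has_derivative f' \<circ> (\<lambda>s. s *\<^sub>R axis i 1)) (at 0)"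
    using assms by (intro diff_chain_at) (auto intro!: derivative_eq_intros)
  moreover have "f' \<circ> (\<lambda>s. s *\<^sub>R axis i 1) = (\<lambda>s. s *\<^sub>R f' (axis i 1))"
    using linear_scale[OF has_derivative_linear[OF assms]] by auto
  ultimately show ?thesis
    by (auto simp: partial_def has_vector_derivative_def o_def intro!: vector_derivative_at)
qed

lemma has_derivative_partial:
  fixes f :: "real ^ 'n::finite \<Rightarrow> complex"
  assumes "f differentiable_on UNIV"
  shows "(f has_derivative (\<lambda>h. \<Sum>i\<in>UNIV. (h $ i) *\<^sub>R partial i f x)) (at x)"
proof -
  obtain f' where f': "(f has_derivative f') (at x)"
    using assms by (auto simp: differentiable_on_def differentiable_def)
  have "f' h = (\<Sum>i\<in>UNIV. (h $ i) *\<^sub>R partial i f x)" for h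
    by (subst (1) vec_eq_sum_axis[of h])
       (simp add: linear_sum[OF has_derivative_linear[OF f']] partial_eqI[OF f']
          linear_scale[OF has_derivative_linear[OF f']])
  hence "f' = (\<lambda>h. \<Sum>i\<in>UNIV. (h $ i) *\<^sub>R partial i f x)" by blast
  thus ?thesis using f' by simp
qed

lemma partial_line_derivative:
  fixes f :: "real ^ 'n::finite \<Rightarrow> complex"
  assumes "f differentiable_on UNIV"
  shows "((\<lambda>s. f (x + s *\<^sub>R axis i 1)) has_vector_derivative partial i f (x + s *\<^sub>R axis i 1)) (at s)"
proof -
  have "(f \<circ> (\<lambda>s. x + s *\<^sub>R axis i 1) has_derivative
      (\<lambda>h. \<Sum>j\<in>UNIV. (h $ j) *\<^sub>R partial j f (x + s *\<^sub>R axis i 1)) \<circ> (\<lambda>s. s *\<^sub>R axis i 1)) (at s)"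
    using has_derivative_partial[OF assms]
    by (intro diff_chain_at) (auto intro!: derivative_eq_intros)
  moreover have "(\<lambda>h. \<Sum>j\<in>UNIV. (h $ j) *\<^sub>R partial j f (x + s *\<^sub>R axis i 1)) \<circ> (\<lambda>s. s *\<^sub>R axis i 1)
      = (\<lambda>r. r *\<^sub>R partial i f (x + s *\<^sub>R axis i 1))"
    by (auto simp: axis_def if_distrib[of "\<lambda>x. x *\<^sub>R _"] if_distrib[of "\<lambda>x. _ * x"] cong: if_cong)
  ultimately show ?thesis
    by (simp add: has_vector_derivative_def o_def)
qed

section \<open>Symmetry of second partial derivatives\<close>

lemma vector_mean_value_bound:
  fixes F :: "real \<Rightarrow> 'a::real_normed_vector"
  assumes "0 \<le> h" "\<And>s. s \<in> {0..h} \<Longrightarrow> (F has_vector_derivative F' s) (at s)"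
    "\<And>s. s \<in> {0..h} \<Longrightarrow> norm (F' s) \<le> B"
  shows "norm (F h - F 0) \<le> B * h"
proof -
  have "norm (F h - F 0) \<le> B * norm (h - 0)"
  proof (rule differentiable_bound[of "{0..h}" F "\<lambda>s x. x *\<^sub>R F' s" B h 0])
    show "onorm (\<lambda>x. x *\<^sub>R F' s) \<le> B" if "s \<in> {0..h}" for s
      using assms(3)[OF that] by (intro onorm_le) (simp add: mult.commute[of B] mult_left_mono)
  qed (use assms in \<open>auto simp: has_vector_derivative_def intro: has_derivative_at_withinI\<close>)
  thus ?thesis using assms(1) by simp
qed

text \<open>The mean value inequality is applied in t to \<open>F1\<close> and then in s to a
  difference of values of F. Subtracting t A and (s h) A beforehand leaves only the deviation of
  \<open>F12\<close> from the constant A to be estimated.\<close>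

lemma second_difference_bound:
  fixes F F1 F12 :: "real \<Rightarrow> real \<Rightarrow> complex"
  assumes "0 \<le> h"
    and "\<And>s t. s \<in> {0..h} \<Longrightarrow> t \<in> {0..h} \<Longrightarrow> ((\<lambda>s. F s t) has_vector_derivative F1 s t) (at s)"
    and "\<And>s t. s \<in> {0..h} \<Longrightarrow> t \<in> {0..h} \<Longrightarrow> ((\<lambda>t. F1 s t) has_vector_derivative F12 s t) (at t)"
    and "\<And>s t. s \<in> {0..h} \<Longrightarrow> t \<in> {0..h} \<Longrightarrow> norm (F12 s t - A) \<le> e"
  shows "norm ((F h h - F h 0) - (F 0 h - F 0 0) - h\<^sup>2 *\<^sub>R A) \<le> e * h\<^sup>2"
proof -
  have 1: "norm (F1 s h - F1 s 0 - h *\<^sub>R A) \<le> e * h" if "s \<in> {0..h}" for s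
  proof -
    have "norm ((F1 s h - h *\<^sub>R A) - (F1 s 0 - 0 *\<^sub>R A)) \<le> e * h"
      by (rule vector_mean_value_bound[where F = "\<lambda>t. F1 s t - t *\<^sub>R A" and F' = "\<lambda>t. F12 s t - A"])
        (use assms(1) assms(3)[OF that] assms(4)[OF that] in \<open>auto intro!: derivative_eq_intros\<close>)
    thus ?thesis by (simp add: algebra_simps)
  qed
  have "norm ((F h h - F h 0 - (h * h) *\<^sub>R A) - (F 0 h - F 0 0 - (0 * h) *\<^sub>R A)) \<le> (e * h) * h"
    by (rule vector_mean_value_bound[where F = "\<lambda>s. F s h - F s 0 - (s * h) *\<^sub>R A"
          and F' = "\<lambda>s. F1 s h - F1 s 0 - h *\<^sub>R A"])
      (use assms(1) assms(2)[of _ h] assms(2)[of _ 0] 1 in \<open>auto intro!: derivative_eq_intros\<close>)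
  thus ?thesis by (simp add: algebra_simps power2_eq_square)
qed

text \<open>One second difference over a small square with corner x is close to h^2 times either
  mixed derivative, according to the order in which it is grouped.\<close>

lemma partial_commute:
  fixes f :: "real ^ 'n::finite \<Rightarrow> complex"
  assumes f: "f differentiable_on UNIV" "\<And>i. partial i f differentiable_on UNIV"
    "\<And>i j. continuous_on UNIV (partial i (partial j f))"
  shows "partial i (partial j f) = partial j (partial i f)"
proof
  fix x
  let ?A = "partial i (partial j f) x" and ?B = "partial j (partial i f) x"
  let ?y = "\<lambda>s t. x + s *\<^sub>R axis i 1 + t *\<^sub>R axis j (1::real)"
  have "norm (?A - ?B) \<le> 2 * e" if "e > 0" for e
  proof -
    have cont: "isCont (partial k (partial l f)) x" for k l
      using f(3) by (simp add: continuous_on_eq_continuous_at)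
    have "\<exists>d>0. \<forall>y. dist y x < d \<longrightarrow> dist (partial k (partial l f) y) (partial k (partial l f) x) < e" for k l
      using cont[of k l] \<open>e > 0\<close> unfolding continuous_at_eps_delta by blast
    then obtain d1 d2 where d: "d1 > 0" "d2 > 0"
      "\<And>y. dist y x < d1 \<Longrightarrow> dist (partial i (partial j f) y) ?A < e"
      "\<And>y. dist y x < d2 \<Longrightarrow> dist (partial j (partial i f) y) ?B < e"
      by metis
    \<comment> \<open>The points of the square lie within 2 h of x, so dividing by 3 keeps them
      strictly inside both balls of continuity.\<close>
    define h where "h = min d1 d2 / 3"
    have h: "h > 0" "2 * h < d1" "2 * h < d2" using d by (auto simp: h_def)
    have near: "dist (?y s t) x \<le> 2 * h" if "s \<in> {0..h}" "t \<in> {0..h}" for s t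
    proof -
      have "dist (?y s t) x \<le> norm (s *\<^sub>R axis i (1::real)) + norm (t *\<^sub>R axis j (1::real))"
        using norm_triangle_ineq[of "s *\<^sub>R axis i (1::real)" "t *\<^sub>R axis j (1::real)"]
        by (simp add: dist_norm add.assoc)
      thus ?thesis using that by simp
    qed
    let ?D = "f (?y h h) - f (?y h 0) - (f (?y 0 h) - f (?y 0 0))"
    have 1: "norm (?D - h\<^sup>2 *\<^sub>R ?B) \<le> e * h\<^sup>2"
    proof (rule second_difference_bound[where F = "\<lambda>s t. f (?y s t)"
            and ?F1.0 = "\<lambda>s t. partial i f (?y s t)" and ?F12.0 = "\<lambda>s t. partial j (partial i f) (?y s t)"])
      show "((\<lambda>s. f (?y s t)) has_vector_derivative partial i f (?y s t)) (at s)" for s t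
        using partial_line_derivative[OF f(1), of "x + t *\<^sub>R axis j 1" i s] by (simp add: algebra_simps)
      show "((\<lambda>t. partial i f (?y s t)) has_vector_derivative partial j (partial i f) (?y s t)) (at t)" for s t
        using partial_line_derivative[OF f(2)] by simp
      show "norm (partial j (partial i f) (?y s t) - ?B) \<le> e" if "s \<in> {0..h}" "t \<in> {0..h}" for s t
        using d(4)[of "?y s t"] near[OF that] h by (simp add: dist_norm)
    qed (use h in auto)
    \<comment> \<open>The same second difference, regrouped so that the two coordinates exchange
      their roles.\<close>
    have 2: "norm ((f (?y h h) - f (?y 0 h)) - (f (?y h 0) - f (?y 0 0)) - h\<^sup>2 *\<^sub>R ?A) \<le> e * h\<^sup>2"
    proof (rule second_difference_bound[where F = "\<lambda>t s. f (?y s t)"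
            and ?F1.0 = "\<lambda>t s. partial j f (?y s t)" and ?F12.0 = "\<lambda>t s. partial i (partial j f) (?y s t)"])
      show "((\<lambda>t. f (?y s t)) has_vector_derivative partial j f (?y s t)) (at t)" for s t
        using partial_line_derivative[OF f(1)] by simp
      show "((\<lambda>s. partial j f (?y s t)) has_vector_derivative partial i (partial j f) (?y s t)) (at s)" for s t
        using partial_line_derivative[OF f(2), of j "x + t *\<^sub>R axis j 1" i s] by (simp add: algebra_simps)
      show "norm (partial i (partial j f) (?y s t) - ?A) \<le> e" if "t \<in> {0..h}" "s \<in> {0..h}" for s t
        using d(3)[of "?y s t"] near[of s t] that h by (simp add: dist_norm)
    qed (use h in auto)
    have "h\<^sup>2 *\<^sub>R (?A - ?B) = (?D - h\<^sup>2 *\<^sub>R ?B)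
        - ((f (?y h h) - f (?y 0 h)) - (f (?y h 0) - f (?y 0 0)) - h\<^sup>2 *\<^sub>R ?A)"
      by (simp add: algebra_simps)
    hence "norm (h\<^sup>2 *\<^sub>R (?A - ?B)) \<le> e * h\<^sup>2 + e * h\<^sup>2"
      by (simp only:) (intro order_trans[OF norm_triangle_ineq4] add_mono 1 2)
    moreover have "norm (h\<^sup>2 *\<^sub>R (?A - ?B)) = h\<^sup>2 * norm (?A - ?B)"
      by (simp only: norm_scaleR abs_power2)
    ultimately have "h\<^sup>2 * norm (?A - ?B) \<le> h\<^sup>2 * (2 * e)"
      by (simp add: mult.commute)
    thus ?thesis using h by simp
  qed
  hence "norm (?A - ?B) \<le> 0 + e" if "e > 0" for e
    using that[THEN half_gt_zero] by fastforce
  hence "norm (?A - ?B) \<le> 0"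
    by (rule field_le_epsilon)
  thus "?A = ?B" by simp
qed

text \<open>A list can be extended at either end, which suits induction on the number of
  derivatives; \<open>mi_partial\<close> prescribes the order of the coordinates and does not
  compose directly.\<close>

definition iter_partial :: "'n::finite list \<Rightarrow> (real ^ 'n \<Rightarrow> complex) \<Rightarrow> real ^ 'n \<Rightarrow> complex" where
  "iter_partial is f = foldr partial is f"

lemma iter_partial_Nil [simp]: "iter_partial [] f = f"
  and iter_partial_Cons [simp]: "iter_partial (i # is) f = partial i (iter_partial is f)"
  and iter_partial_append: "iter_partial (is @ js) f = iter_partial is (iter_partial js f)"
  by (simp_all add: iter_partial_def)

lemma iter_partial_partial: "iter_partial is (partial i f) = iter_partial (is @ [i]) f"
  by (simp add: iter_partial_append)

lemma smooth_differentiable: "smooth f \<Longrightarrow> f differentiable_on UNIV"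
  using C_k.simps(2) smooth_def by blast

lemma smooth_continuous: "smooth f \<Longrightarrow> continuous_on UNIV f"
  using smooth_differentiable differentiable_imp_continuous_on by blast

lemma smooth_partial: "smooth f \<Longrightarrow> smooth (partial i f)"
  unfolding smooth_def using C_k.simps(2) by blast

lemma smooth_iter_partial: "smooth f \<Longrightarrow> smooth (iter_partial is f)"
  by (induction "is") (auto intro: smooth_partial)

text \<open>The classes met below (linear combinations, convolutions, tensor products) are stable
  under all partial derivatives at once. This makes an invariant more convenient than the counting
  of derivatives in \<open>C_k\<close>.\<close>

lemma smooth_coinduct:
  assumes "f \<in> X" "\<And>g. g \<in> X \<Longrightarrow> g differentiable_on UNIV"
    "\<And>g i. g \<in> X \<Longrightarrow> partial i g \<in> X"
  shows "smooth f"
proof -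
  have "C_k k g" if "g \<in> X" for k g
    using that by (induction k arbitrary: g) (auto intro: differentiable_imp_continuous_on assms)
  thus ?thesis using assms(1) by (simp add: smooth_def)
qed

lemma smooth_partial_commute: "smooth f \<Longrightarrow> partial i (partial j f) = partial j (partial i f)"
  by (intro partial_commute smooth_differentiable smooth_partial smooth_continuous)

lemma iter_partial_partial_swap:
  "smooth f \<Longrightarrow> iter_partial is (partial i f) = partial i (iter_partial is f)"
  by (induction "is") (auto simp: smooth_partial_commute smooth_iter_partial)

text \<open>The head of \<open>is\<close> is located inside \<open>js\<close> and commuted to the
  front past the entries before it.\<close>

lemma iter_partial_mset_cong:
  "smooth f \<Longrightarrow> mset is = mset js \<Longrightarrow> iter_partial is f = iter_partial js f"
proof (induction "is" arbitrary: js)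
  case (Cons i "is")
  then obtain as bs where js: "js = as @ i # bs"
    by (metis split_list list.set_intros(1) set_mset_mset)
  hence "mset is = mset (as @ bs)" using Cons.prems(2) by simp
  hence "iter_partial is f = iter_partial (as @ bs) f" using Cons by blast
  thus ?case
    using iter_partial_partial_swap[OF smooth_iter_partial[OF Cons.prems(1)], of as i bs]
    by (simp add: js iter_partial_append)
qed simp

text \<open>Lists the coordinates in exactly the order in which \<open>mi_partial\<close>
  differentiates, so that comparing the two is an identity. Commutation of derivatives enters only
  for lists in another order.\<close>

definition mi_list :: "('n::finite \<Rightarrow> nat) \<Rightarrow> 'n list" where
  "mi_list \<alpha> = concat (map (\<lambda>i. replicate (\<alpha> i) i) coords)"

lemma coords: "distinct (coords :: 'n::finite list)" "set (coords :: 'n list) = UNIV"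
proof -
  have "\<exists>is::'n list. distinct is \<and> set is = UNIV"
    using finite_distinct_list[of "UNIV :: 'n set"] by auto
  from someI_ex[OF this]
  show "distinct (coords :: 'n::finite list)" "set (coords :: 'n list) = UNIV"
    unfolding coords_def by auto
qed

lemma mi_partial_eq_iter_partial: "mi_partial \<alpha> f = iter_partial (mi_list \<alpha>) f"
proof -
  have rep: "(partial i ^^ k) g = iter_partial (replicate k i) g" for i k and g :: "real ^ 'n \<Rightarrow> complex"
    by (induction k) auto
  have "foldr (\<lambda>i g. (partial i ^^ \<alpha> i) g) is f
      = iter_partial (concat (map (\<lambda>i. replicate (\<alpha> i) i) is)) f" for "is"
    by (induction "is") (auto simp: rep iter_partial_append)
  thus ?thesis by (simp add: mi_partial_def mi_list_def)
qed

lemma count_mi_list: "count (mset (mi_list \<alpha>)) i = \<alpha> i"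
proof -
  have "count (mset (concat (map (\<lambda>i. replicate (\<alpha> i) i) is))) i = (if i \<in> set is then \<alpha> i else 0)"
    if "distinct is" for "is"
    using that by (induction "is") auto
  from this[OF coords(1)] show ?thesis by (simp add: mi_list_def coords(2))
qed

lemma length_mi_list: "length (mi_list \<alpha>) = mi_size \<alpha>"
proof -
  have "length (mi_list \<alpha>) = sum_list (map \<alpha> coords)"
    by (simp add: mi_list_def length_concat o_def)
  thus ?thesis by (simp add: sum_list_distinct_conv_sum_set coords mi_size_def)
qed

lemma mi_partial_eqI:
  assumes "smooth f" "\<And>i. count (mset is) i = \<alpha> i"
  shows "mi_partial \<alpha> f = iter_partial is f"
  using assms by (simp add: mi_partial_eq_iter_partial)
    (rule iter_partial_mset_cong, auto intro!: multiset_eqI simp: count_mi_list)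

lemma iter_partial_eq_mi_partial:
  "smooth f \<Longrightarrow> iter_partial is f = mi_partial (count (mset is)) f"
  using mi_partial_eqI by metis

lemma mi_size_count: "mi_size (count (mset is)) = length is"
  by (metis length_mi_list count_mi_list multiset_eqI size_mset)

section \<open>Schwartz functions\<close>

lemma schwartz_iff_iter_partial:
  "\<psi> \<in> schwartz \<longleftrightarrow> smooth \<psi> \<and>
     (\<forall>N is. \<exists>B. \<forall>x. norm (iter_partial is \<psi> x) * (1 + norm x) ^ N \<le> B)"
proof -
  \<comment> \<open>Every list is a rearrangement of the list of some multi-index, so for smooth
    functions both quantifiers range over the same derivatives.\<close>
  have "(\<forall>\<alpha>. P (mi_partial \<alpha> \<psi>)) \<longleftrightarrow> (\<forall>is. P (iter_partial is \<psi>))" if "smooth \<psi>" for P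
    using that by (metis iter_partial_eq_mi_partial mi_partial_eq_iter_partial)
  note * = this[of "\<lambda>f. \<exists>B. \<forall>x. norm (f x) * (1 + norm x) ^ N \<le> B" for N]
  have **: "bounded (range (\<lambda>x. (1 + norm x) ^ N *\<^sub>R f x))
      \<longleftrightarrow> (\<exists>B. \<forall>x. norm (f x) * (1 + norm x) ^ N \<le> B)"
    for N and f :: "real ^ 'n \<Rightarrow> complex"
    by (auto simp: bounded_iff norm_power mult.commute abs_of_nonneg)
  show ?thesis unfolding schwartz_def mem_Collect_eq ** using * by blast
qed

lemma schwartz_smooth: "\<psi> \<in> schwartz \<Longrightarrow> smooth \<psi>"
  by (simp add: schwartz_def)

lemma schwartz_decay:
  assumes "\<psi> \<in> schwartz"
  obtains B where "B \<ge> 0" "\<And>x. norm (iter_partial is \<psi> x) * (1 + norm x) ^ N \<le> B"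
proof -
  obtain B where "\<And>x. norm (iter_partial is \<psi> x) * (1 + norm x) ^ N \<le> B"
    using assms schwartz_iff_iter_partial by blast
  thus ?thesis
    using that[of "max B 0"] by (meson max.cobounded1 max.cobounded2 order_trans)
qed

text \<open>As the class is closed under derivatives, decay has to be checked only for its members
  themselves and never for their derivatives.\<close>

lemma schwartz_coinduct:
  assumes "\<psi> \<in> X" "\<And>g. g \<in> X \<Longrightarrow> g differentiable_on UNIV"
    "\<And>g i. g \<in> X \<Longrightarrow> partial i g \<in> X"
    "\<And>g N. g \<in> X \<Longrightarrow> \<exists>B. \<forall>x. norm (g x) * (1 + norm x) ^ N \<le> B"
  shows "\<psi> \<in> schwartz"
proof -
  have "iter_partial is \<psi> \<in> X" for "is"
    by (induction "is") (auto intro: assms)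
  thus ?thesis
    unfolding schwartz_iff_iter_partial using smooth_coinduct[OF assms(1-3)] assms(4) by blast
qed

lemma schwartz_partial: "\<psi> \<in> schwartz \<Longrightarrow> partial i \<psi> \<in> schwartz"
  by (auto simp: schwartz_iff_iter_partial smooth_partial iter_partial_partial)

lemma schwartz_iter_partial: "\<psi> \<in> schwartz \<Longrightarrow> iter_partial is \<psi> \<in> schwartz"
  by (induction "is") (auto intro: schwartz_partial)

lemma schwartz_bound:
  assumes "\<psi> \<in> schwartz"
  obtains B where "B \<ge> 0" "\<And>x. norm (\<psi> x) * (1 + norm x) ^ N \<le> B"
  using schwartz_decay[OF assms, of "[]" N] by auto

section \<open>Linear combinations\<close>

lemma partial_lincomb:
  assumes "f differentiable_on UNIV" "g differentiable_on UNIV"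
  shows "partial i (\<lambda>x. a * f x + b * g x) = (\<lambda>x. a * partial i f x + b * partial i g x)"
proof
  fix x
  have "((\<lambda>x. a * f x + b * g x) has_derivative
     (\<lambda>h. a * (\<Sum>i\<in>UNIV. (h $ i) *\<^sub>R partial i f x) + b * (\<Sum>i\<in>UNIV. (h $ i) *\<^sub>R partial i g x))) (at x)"
    by (intro derivative_intros has_derivative_partial assms)
  from partial_eqI[OF this, of i]
  show "partial i (\<lambda>x. a * f x + b * g x) x = a * partial i f x + b * partial i g x"
    by (simp add: axis_def if_distrib[of "\<lambda>x. x *\<^sub>R _"] cong: if_cong)
qed

lemma differentiable_lincomb:
  fixes f g :: "real ^ 'n::finite \<Rightarrow> complex"
  assumes "f differentiable_on UNIV" "g differentiable_on UNIV"
  shows "(\<lambda>x. a * f x + b * g x) differentiable_on UNIV"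
  using assms by (intro derivative_intros differentiable_on_mult differentiable_on_const differentiable_on_add)

lemma smooth_lincomb:
  assumes "smooth f" "smooth g"
  shows "smooth (\<lambda>x. a * f x + b * g x)"
proof (rule smooth_coinduct[of _ "{(\<lambda>x. a * f x + b * g x) | f g. smooth f \<and> smooth g}"])
  show "partial i h \<in> {(\<lambda>x. a * f x + b * g x) | f g. smooth f \<and> smooth g}"
    if "h \<in> {(\<lambda>x. a * f x + b * g x) | f g. smooth f \<and> smooth g}" for h i
    using that by (force simp: partial_lincomb smooth_differentiable intro: smooth_partial)
qed (use assms in \<open>auto intro!: differentiable_lincomb intro: smooth_differentiable\<close>)

lemma schwartz_lincomb:
  assumes "f \<in> schwartz" "g \<in> schwartz"
  shows "(\<lambda>x. a * f x + b * g x) \<in> schwartz"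
proof (rule schwartz_coinduct[of _ "{(\<lambda>x. a * f x + b * g x) | f g. f \<in> schwartz \<and> g \<in> schwartz}"])
  show "partial i h \<in> {(\<lambda>x. a * f x + b * g x) | f g. f \<in> schwartz \<and> g \<in> schwartz}"
    if "h \<in> {(\<lambda>x. a * f x + b * g x) | f g. f \<in> schwartz \<and> g \<in> schwartz}" for h i
    using that by (force simp: partial_lincomb smooth_differentiable schwartz_smooth intro: schwartz_partial)
  show "\<exists>B. \<forall>x. norm (h x) * (1 + norm x) ^ N \<le> B"
    if "h \<in> {(\<lambda>x. a * f x + b * g x) | f g. f \<in> schwartz \<and> g \<in> schwartz}" for h N
  proof -
    from that obtain f g where h: "h = (\<lambda>x. a * f x + b * g x)" and fg: "f \<in> schwartz" "g \<in> schwartz"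
      by blast
    obtain B where B: "\<And>x. norm (f x) * (1 + norm x) ^ N \<le> B" using schwartz_bound[OF fg(1)] by metis
    obtain C where C: "\<And>x. norm (g x) * (1 + norm x) ^ N \<le> C" using schwartz_bound[OF fg(2)] by metis
    have "norm (h x) * (1 + norm x) ^ N \<le> norm a * B + norm b * C" for x
    proof -
      have "norm (h x) * (1 + norm x) ^ N \<le> (norm a * norm (f x) + norm b * norm (g x)) * (1 + norm x) ^ N"
        unfolding h by (intro mult_right_mono order_trans[OF norm_triangle_ineq]) (auto simp: norm_mult)
      also have "\<dots> = norm a * (norm (f x) * (1 + norm x) ^ N) + norm b * (norm (g x) * (1 + norm x) ^ N)"
        by (simp add: algebra_simps)
      also have "\<dots> \<le> norm a * B + norm b * C"
        by (intro add_mono mult_left_mono B C) auto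
      finally show ?thesis .
    qed
    thus ?thesis by blast
  qed
qed (use assms in \<open>auto intro!: differentiable_lincomb intro: smooth_differentiable schwartz_smooth\<close>)

section \<open>Affine substitutions\<close>

lemma partial_affine:
  fixes f :: "real ^ 'n::finite \<Rightarrow> complex"
  assumes "f differentiable_on UNIV"
  shows "partial i (\<lambda>y. a * f (c *\<^sub>R y + v)) = (\<lambda>y. (a * of_real c) * partial i f (c *\<^sub>R y + v))"
    and "(\<lambda>y. a * f (c *\<^sub>R y + v)) differentiable_on UNIV"
proof -
  have *: "((\<lambda>y. a * f (c *\<^sub>R y + v)) has_derivative
     (\<lambda>h. a * (\<Sum>i\<in>UNIV. ((c *\<^sub>R h) $ i) *\<^sub>R partial i f (c *\<^sub>R y + v)))) (at y)" for y
    by (rule has_derivative_mult_right, rule has_derivative_compose[OF _ has_derivative_partial[OF assms]])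
       (auto intro!: derivative_eq_intros)
  show "partial i (\<lambda>y. a * f (c *\<^sub>R y + v)) = (\<lambda>y. (a * of_real c) * partial i f (c *\<^sub>R y + v))"
  proof
    fix y
    show "partial i (\<lambda>y. a * f (c *\<^sub>R y + v)) y = (a * of_real c) * partial i f (c *\<^sub>R y + v)"
      using partial_eqI[OF *, of i y]
      by (simp add: axis_def if_distrib[of "\<lambda>x. x *\<^sub>R _"] if_distrib[of "\<lambda>x. _ * x"] cong: if_cong)
        (simp add: scaleR_conv_of_real)
  qed
  show "(\<lambda>y. a * f (c *\<^sub>R y + v)) differentiable_on UNIV"
    using * by (auto simp: differentiable_on_def differentiable_def)
qed

lemma iter_partial_affine:
  assumes "smooth f"
  shows "iter_partial is (\<lambda>y. a * f (c *\<^sub>R y + v))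
    = (\<lambda>y. (a * of_real c ^ length is) * iter_partial is f (c *\<^sub>R y + v))"
proof (induction "is")
  case (Cons i "is")
  thus ?case
    by (simp add: partial_affine(1) smooth_differentiable smooth_iter_partial assms) (simp add: mult_ac)
qed simp

text \<open>The invariant class keeps c and v fixed but lets the factor a vary, because each
  derivative contributes one more factor c.\<close>

lemma schwartz_affine:
  assumes "\<phi> \<in> schwartz" "c \<noteq> 0"
  shows "(\<lambda>y. a * \<phi> (c *\<^sub>R y + v)) \<in> schwartz"
proof (rule schwartz_coinduct[of _ "{(\<lambda>y. a * \<phi> (c *\<^sub>R y + v)) | a \<phi>. \<phi> \<in> schwartz}"])
  show "partial i h \<in> {(\<lambda>y. a * \<phi> (c *\<^sub>R y + v)) | a \<phi>. \<phi> \<in> schwartz}"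
    if "h \<in> {(\<lambda>y. a * \<phi> (c *\<^sub>R y + v)) | a \<phi>. \<phi> \<in> schwartz}" for h i
    using that by (force simp: partial_affine smooth_differentiable schwartz_smooth intro: schwartz_partial)
  show "\<exists>B. \<forall>x. norm (h x) * (1 + norm x) ^ N \<le> B"
    if "h \<in> {(\<lambda>y. a * \<phi> (c *\<^sub>R y + v)) | a \<phi>. \<phi> \<in> schwartz}" for h N
  proof -
    from that obtain a \<phi> where h: "h = (\<lambda>y. a * \<phi> (c *\<^sub>R y + v))" and \<phi>: "\<phi> \<in> schwartz" by blast
    obtain B where B: "\<And>x. norm (\<phi> x) * (1 + norm x) ^ N \<le> B" using schwartz_bound[OF \<phi>] by metis
    \<comment> \<open>Inverting y -> c y + v costs 1/|c|; the translation is absorbed by 1 + |v|,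
      and the leading 1 accounts for the constant in the weight.\<close>
    define K where "K = (1 + 1 / \<bar>c\<bar>) * (1 + norm v)"
    have K: "1 + norm y \<le> K * (1 + norm (c *\<^sub>R y + v))" for y
    proof -
      have "\<bar>c\<bar> * norm y \<le> norm (c *\<^sub>R y + v) + norm v"
        using norm_triangle_ineq4[of "c *\<^sub>R y + v" v] by simp
      hence "norm y \<le> (1 / \<bar>c\<bar>) * (norm (c *\<^sub>R y + v) + norm v)"
        using \<open>c \<noteq> 0\<close> by (simp add: field_simps)
      also have "\<dots> \<le> (1 / \<bar>c\<bar>) * ((1 + norm v) * (1 + norm (c *\<^sub>R y + v)))"
        by (intro mult_left_mono) (auto simp: algebra_simps)
      finally have "norm y \<le> (1 / \<bar>c\<bar>) * ((1 + norm v) * (1 + norm (c *\<^sub>R y + v)))" .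
      moreover have "1 \<le> (1 + norm v) * (1 + norm (c *\<^sub>R y + v))"
        by (simp add: algebra_simps)
      moreover have "K * (1 + norm (c *\<^sub>R y + v)) = (1 + norm v) * (1 + norm (c *\<^sub>R y + v))
          + (1 / \<bar>c\<bar>) * ((1 + norm v) * (1 + norm (c *\<^sub>R y + v)))"
        by (simp only: K_def distrib_right mult_1_left mult.assoc)
      ultimately show ?thesis by linarith
    qed
    have "norm (h y) * (1 + norm y) ^ N \<le> norm a * K ^ N * B" for y
    proof -
      have "norm (h y) * (1 + norm y) ^ N \<le> norm (h y) * (K * (1 + norm (c *\<^sub>R y + v))) ^ N"
        by (intro mult_left_mono power_mono K) auto
      also have "\<dots> = norm a * K ^ N * (norm (\<phi> (c *\<^sub>R y + v)) * (1 + norm (c *\<^sub>R y + v)) ^ N)"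
        by (simp add: h norm_mult power_mult_distrib)
      also have "\<dots> \<le> norm a * K ^ N * B"
        by (intro mult_left_mono B) (auto simp: K_def)
      finally show ?thesis .
    qed
    thus ?thesis by blast
  qed
qed (use assms in \<open>auto intro!: partial_affine(2) intro: smooth_differentiable schwartz_smooth\<close>)

section \<open>Seminorms and convolutions\<close>

lemma zero_mem_mi_upto: "(\<lambda>_. 0) \<in> mi_upto (int d)"
  by (simp add: mi_upto_def mi_size_def)

text \<open>Together with \<open>le_schwartz_seminorm\<close> this replaces the suprema by pointwise
  bounds over lists. The powers of -i in \<open>mi_D\<close> have modulus one and drop out.\<close>

lemma schwartz_seminorm_le:
  assumes "\<And>is x. length is \<le> d \<Longrightarrow> norm (iter_partial is \<psi> x) * (1 + norm x) ^ d \<le> B"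
  shows "schwartz_seminorm d \<psi> \<le> B"
  unfolding schwartz_seminorm_def
proof (intro cSUP_least)
  show "mi_upto (int d) \<noteq> {}" using zero_mem_mi_upto by auto
  show "norm ((1 + norm x) ^ d *\<^sub>R mi_D \<alpha> \<psi> x) \<le> B" if "\<alpha> \<in> mi_upto (int d)" for \<alpha> x
    using assms[of "mi_list \<alpha>" x] that
    by (simp add: mi_upto_def length_mi_list mi_D_def norm_mult norm_power mi_partial_eq_iter_partial
        mult.commute)
qed auto

lemma le_schwartz_seminorm:
  assumes "\<psi> \<in> schwartz" "length is \<le> d"
  shows "norm (iter_partial is \<psi> x) * (1 + norm x) ^ d \<le> schwartz_seminorm d \<psi>"
proof -
  let ?f = "\<lambda>\<alpha> x. norm ((1 + norm x) ^ d *\<^sub>R mi_D \<alpha> \<psi> x)"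
  have f: "?f \<alpha> x = norm (iter_partial (mi_list \<alpha>) \<psi> x) * (1 + norm x) ^ d" for \<alpha> x
    by (simp add: mi_D_def norm_mult norm_power mi_partial_eq_iter_partial mult.commute)
  define \<alpha> where "\<alpha> = count (mset is)"
  have \<alpha>: "\<alpha> \<in> mi_upto (int d)"
    using assms(2) by (simp add: \<alpha>_def mi_upto_def mi_size_count)
  have "iter_partial is \<psi> = iter_partial (mi_list \<alpha>) \<psi>"
    using assms(1) by (simp add: \<alpha>_def iter_partial_eq_mi_partial schwartz_smooth
        flip: mi_partial_eq_iter_partial)
  hence "norm (iter_partial is \<psi> x) * (1 + norm x) ^ d = ?f \<alpha> x"
    by (simp only: f)
  also have "\<dots> \<le> (SUP x. ?f \<alpha> x)"
  \<comment> \<open>A supremum of reals bounds its members only if the set is bounded above: for the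
    inner one this is the decay of \<open>\<psi>\<close>, for the outer one the finiteness of the
    set of multi-indices.\<close>
  proof (rule cSUP_upper)
    obtain B where "\<And>x. norm (iter_partial (mi_list \<alpha>) \<psi> x) * (1 + norm x) ^ d \<le> B"
      using schwartz_decay[OF assms(1)] by metis
    thus "bdd_above (range (?f \<alpha>))" unfolding f by (rule bdd_aboveI2)
  qed auto
  also have "\<dots> \<le> schwartz_seminorm d \<psi>"
    unfolding schwartz_seminorm_def
    by (rule cSUP_upper[OF \<alpha>]) (simp add: finite_mi_upto)
  finally show ?thesis .
qed

lemma schwartz_seminorm_nonneg:
  assumes "\<psi> \<in> schwartz"
  shows "0 \<le> schwartz_seminorm d \<psi>"
proof -
  have "0 \<le> norm (iter_partial [] \<psi> 0) * (1 + norm (0 :: real ^ 'a)) ^ d" by simp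
  also have "\<dots> \<le> schwartz_seminorm d \<psi>"
    by (rule le_schwartz_seminorm[OF assms]) simp
  finally show ?thesis .
qed

text \<open>Peetre's inequality in its simplest form: it moves polynomial weights between y, x and x
  - y.\<close>

lemma one_plus_norm_add_le: "1 + norm (x + y) \<le> (1 + norm x) * (1 + norm y)"
proof -
  have "(1 + norm x) * (1 + norm y) = 1 + norm x + norm y + norm x * norm y"
    by (simp add: algebra_simps)
  thus ?thesis
    using norm_triangle_ineq[of x y] mult_nonneg_nonneg[OF norm_ge_zero norm_ge_zero, of x y] by linarith
qed

text \<open>The mean value inequality on the segment from 0 to x gains one factor |x|, while the
  weights only grow along the segment. Repeated use turns bounds on high derivatives into Taylor
  estimates; the factor \<open>CARD('n)\<close> comes from summing over the coordinates.\<close>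

lemma gradient_growth_bound:
  fixes f :: "real ^ 'n::finite \<Rightarrow> complex" and B :: real
  assumes f: "f differentiable_on UNIV" "f 0 = 0" and "0 \<le> B"
    and B: "\<And>i y. norm (partial i f y) \<le> B * norm y ^ k * (1 + norm y) ^ N"
  shows "norm (f x) \<le> (real CARD('n) * B) * norm x ^ Suc k * (1 + norm x) ^ N"
proof -
  let ?M = "B * norm x ^ k * (1 + norm x) ^ N"
  have "norm (f (1 *\<^sub>R x) - f (0 *\<^sub>R x)) \<le> (CARD('n) * (norm x * ?M)) * 1"
  proof (rule vector_mean_value_bound[where F = "\<lambda>s. f (s *\<^sub>R x)"])
    fix s :: real assume s: "s \<in> {0..1}"
    have "(f \<circ> (\<lambda>s. s *\<^sub>R x) has_derivative
        (\<lambda>h. \<Sum>i\<in>UNIV. (h $ i) *\<^sub>R partial i f (s *\<^sub>R x)) \<circ> (\<lambda>s. s *\<^sub>R x)) (at s)"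
      by (intro diff_chain_at has_derivative_partial f) (auto intro!: derivative_eq_intros)
    thus "((\<lambda>s. f (s *\<^sub>R x)) has_vector_derivative
        (\<Sum>i\<in>UNIV. (x $ i) *\<^sub>R partial i f (s *\<^sub>R x))) (at s)"
      by (simp add: has_vector_derivative_def o_def scaleR_sum_right)
    have "norm (\<Sum>i\<in>UNIV. (x $ i) *\<^sub>R partial i f (s *\<^sub>R x)) \<le> (\<Sum>i\<in>(UNIV::'n set). norm x * ?M)"
    proof (rule sum_norm_le)
      fix i
      have "norm (s *\<^sub>R x) \<le> norm x"
        using s by (simp add: mult_left_le_one_le)
      hence "B * norm (s *\<^sub>R x) ^ k * (1 + norm (s *\<^sub>R x)) ^ N \<le> ?M"
        using \<open>0 \<le> B\<close> by (intro mult_mono power_mono mult_left_mono) auto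
      hence "norm (partial i f (s *\<^sub>R x)) \<le> ?M"
        using B[of i "s *\<^sub>R x"] by linarith
      thus "norm ((x $ i) *\<^sub>R partial i f (s *\<^sub>R x)) \<le> norm x * ?M"
        unfolding norm_scaleR by (intro mult_mono) (auto simp: component_le_norm_cart)
    qed
    thus "norm (\<Sum>i\<in>UNIV. (x $ i) *\<^sub>R partial i f (s *\<^sub>R x)) \<le> CARD('n) * (norm x * ?M)" by simp
  qed simp
  thus ?thesis by (simp add: f(2) mult_ac)
qed

section \<open>Finite sums of Schwartz functions\<close>

lemma schwartz_sum:
  fixes f :: "'a \<Rightarrow> real ^ 'n::finite \<Rightarrow> complex"
  assumes "finite A" "\<And>i. i \<in> A \<Longrightarrow> f i \<in> schwartz"
  shows "(\<lambda>x. \<Sum>i\<in>A. a i * f i x) \<in> schwartz"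
  using assms
proof (induction A rule: finite_induct)
  case empty
  have zero: "(\<lambda>x :: real ^ 'n. 0) \<in> schwartz"
  proof (rule schwartz_coinduct[of _ "{\<lambda>x. 0}"])
    show "partial i g \<in> {\<lambda>x. 0}" if "g \<in> {\<lambda>x. 0}" for i and g :: "real ^ 'n \<Rightarrow> complex"
      using that by (auto simp: partial_def)
  qed auto
  show ?case using zero by simp
next
  case (insert i A)
  have "(\<lambda>x. a i * f i x + 1 * (\<Sum>i\<in>A. a i * f i x)) \<in> schwartz"
    by (intro schwartz_lincomb insert) auto
  thus ?case using insert by simp
qed

lemma iter_partial_lincomb:
  assumes "smooth f" "smooth g"
  shows "iter_partial is (\<lambda>x. a * f x + b * g x) = (\<lambda>x. a * iter_partial is f x + b * iter_partial is g x)"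
  by (induction "is") (simp_all add: partial_lincomb smooth_differentiable smooth_iter_partial assms)

text \<open>Smoothness and the formula are proved together, since the inductive step differentiates
  a linear combination whose second function is the remaining sum.\<close>

lemma iter_partial_sum:
  assumes "finite A" "\<And>i. i \<in> A \<Longrightarrow> smooth (f i)"
  shows "smooth (\<lambda>x. \<Sum>i\<in>A. a i * f i x) \<and>
    iter_partial is (\<lambda>x. \<Sum>i\<in>A. a i * f i x) = (\<lambda>x. \<Sum>i\<in>A. a i * iter_partial is (f i) x)"
  using assms
proof (induction A rule: finite_induct)
  case empty
  have "iter_partial is (\<lambda>x. 0) = (\<lambda>x. 0)"
    by (induction "is") (auto simp: partial_def)
  moreover have "smooth (\<lambda>x. 0)"
    using schwartz_sum[of "{}"] schwartz_smooth by fastforce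
  ultimately show ?case by simp
next
  case (insert i A)
  have "smooth (\<lambda>x. a i * f i x + 1 * (\<Sum>i\<in>A. a i * f i x))"
    by (intro smooth_lincomb) (use insert in auto)
  moreover have "iter_partial is (\<lambda>x. a i * f i x + 1 * (\<Sum>i\<in>A. a i * f i x))
      = (\<lambda>x. a i * iter_partial is (f i) x + 1 * iter_partial is (\<lambda>x. \<Sum>i\<in>A. a i * f i x) x)"
    by (intro iter_partial_lincomb) (use insert in auto)
  ultimately show ?case using insert by simp
qed

text \<open>The partial derivatives of the remainder in h are increments of the partial derivatives
  of f, so \<open>gradient_growth_bound\<close> applies twice. The weight stays at z, as required
  for a seminorm estimate that is uniform in z.\<close>

lemma first_order_remainder_bound:
  fixes f :: "real ^ 'n::finite \<Rightarrow> complex"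
  assumes "smooth f"
    and B: "\<And>i j w. norm (partial j (partial i f) w) * (1 + norm w) ^ d \<le> B"
  shows "norm (f (z + h) - f z - (\<Sum>i\<in>UNIV. (h $ i) *\<^sub>R partial i f z)) * (1 + norm z) ^ d
    \<le> (real CARD('n) * real CARD('n) * B) * norm h ^ 2 * (1 + norm h) ^ d"
proof -
  let ?B = "B / (1 + norm z) ^ d"
  have d: "f differentiable_on UNIV" "\<And>i. partial i f differentiable_on UNIV"
    using assms(1) by (auto intro: smooth_differentiable smooth_partial)
  \<comment> \<open>Any instance of the hypothesis shows that B is nonnegative;
    \<open>undefined\<close> merely supplies some coordinate.\<close>
  have "0 \<le> norm (partial undefined (partial undefined f) 0) * (1 + norm (0 :: real ^ 'n)) ^ d" by simp
  also have "\<dots> \<le> B" by (rule B)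
  finally have "0 \<le> B" .
  have pos: "(1 + norm z) ^ d > 0"
    by (smt (verit) norm_ge_zero zero_less_power)
  have shift: "((\<lambda>h. g (z + h)) has_derivative (\<lambda>k. \<Sum>i\<in>UNIV. (k $ i) *\<^sub>R partial i g (z + h))) (at h)"
    if "g differentiable_on UNIV" for g h
    by (rule has_derivative_compose[OF _ has_derivative_partial[OF that]])
       (auto intro!: derivative_eq_intros)
  \<comment> \<open>Transferring the weight from z + h to z costs a factor (1 + |h|)^d.\<close>
  have 2: "norm (partial j (partial i f) (z + h)) \<le> ?B * norm h ^ 0 * (1 + norm h) ^ d" for i j h
  proof -
    have "1 + norm z \<le> (1 + norm (z + h)) * (1 + norm h)"
      using one_plus_norm_add_le[of "z + h" "- h"] by simp
    hence "norm (partial j (partial i f) (z + h)) * (1 + norm z) ^ d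
        \<le> norm (partial j (partial i f) (z + h)) * ((1 + norm (z + h)) * (1 + norm h)) ^ d"
      by (intro mult_left_mono power_mono) auto
    also have "\<dots> = (norm (partial j (partial i f) (z + h)) * (1 + norm (z + h)) ^ d) * (1 + norm h) ^ d"
      by (simp add: power_mult_distrib)
    also have "\<dots> \<le> B * (1 + norm h) ^ d"
      by (intro mult_right_mono B) auto
    finally show ?thesis using pos by (simp add: field_simps)
  qed
  have 1: "norm (partial i f (z + h) - partial i f z) \<le> (CARD('n) * ?B) * norm h ^ 1 * (1 + norm h) ^ d"
    for i h
  proof -
    have der: "((\<lambda>h. partial i f (z + h) - partial i f z) has_derivative
        (\<lambda>k. \<Sum>j\<in>UNIV. (k $ j) *\<^sub>R partial j (partial i f) (z + h))) (at h)" for h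
      using has_derivative_diff[OF shift[OF d(2)] has_derivative_const] by simp
    have "norm (partial i f (z + h) - partial i f z)
        \<le> (CARD('n) * ?B) * norm h ^ Suc 0 * (1 + norm h) ^ d"
    proof (rule gradient_growth_bound[where f = "\<lambda>h. partial i f (z + h) - partial i f z"])
      show "norm (partial j (\<lambda>h. partial i f (z + h) - partial i f z) h) \<le> ?B * norm h ^ 0 * (1 + norm h) ^ d" for j h
        using 2[of j i h] partial_eqI[OF der, of j h]
        by (simp add: axis_def if_distrib[of "\<lambda>x. x *\<^sub>R _"] cong: if_cong)
    qed (use der \<open>0 \<le> B\<close> pos in \<open>auto simp: differentiable_on_def differentiable_def\<close>)
    thus ?thesis by simp
  qed
  have der: "((\<lambda>h. f (z + h) - f z - (\<Sum>i\<in>UNIV. (h $ i) *\<^sub>R partial i f z)) has_derivative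
      (\<lambda>k. (\<Sum>j\<in>UNIV. (k $ j) *\<^sub>R partial j f (z + h)) - 0 - (\<Sum>i\<in>UNIV. (k $ i) *\<^sub>R partial i f z))) (at h)" for h
    by (intro has_derivative_diff shift d has_derivative_const has_derivative_sum
        has_derivative_scaleR_left bounded_linear_imp_has_derivative bounded_linear_vec_nth)
  have "norm (f (z + h) - f z - (\<Sum>i\<in>UNIV. (h $ i) *\<^sub>R partial i f z))
      \<le> (CARD('n) * (CARD('n) * ?B)) * norm h ^ Suc 1 * (1 + norm h) ^ d"
  proof (rule gradient_growth_bound[where f = "\<lambda>h. f (z + h) - f z - (\<Sum>i\<in>UNIV. (h $ i) *\<^sub>R partial i f z)"])
    show "norm (partial j (\<lambda>h. f (z + h) - f z - (\<Sum>i\<in>UNIV. (h $ i) *\<^sub>R partial i f z)) h)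
        \<le> (CARD('n) * ?B) * norm h ^ 1 * (1 + norm h) ^ d" for j h
      using 1[of j h] partial_eqI[OF der, of j h]
      by (simp add: axis_def if_distrib[of "\<lambda>x. x *\<^sub>R _"] cong: if_cong)
  qed (use der \<open>0 \<le> B\<close> pos in \<open>auto simp: differentiable_on_def differentiable_def\<close>)
  hence "norm (f (z + h) - f z - (\<Sum>i\<in>UNIV. (h $ i) *\<^sub>R partial i f z)) * (1 + norm z) ^ d
      \<le> ((CARD('n) * (CARD('n) * ?B)) * norm h ^ Suc 1 * (1 + norm h) ^ d) * (1 + norm z) ^ d"
    using pos by (intro mult_right_mono) auto
  also have "\<dots> = (real CARD('n) * real CARD('n) * B) * norm h ^ 2 * (1 + norm h) ^ d * ((1 + norm z) ^ d / (1 + norm z) ^ d)"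
    by (simp add: power2_eq_square)
  also have "(1 + norm z) ^ d / (1 + norm z) ^ d = 1"
    using pos by (intro divide_self) linarith
  finally show ?thesis by simp
qed

text \<open>Serves two purposes: differentiating a convolution, and differentiating at the origin a
  function that is flat there.\<close>

lemma has_derivative_quadraticI:
  assumes "bounded_linear L"
    and K: "\<And>h. norm h \<le> 1 \<Longrightarrow> norm (f (x + h) - f x - L h) \<le> K * norm h ^ 2"
  shows "(f has_derivative L) (at x)"
proof (rule has_derivativeI_sandwich[where e = 1 and H = "\<lambda>y. K * norm (y - x)"])
  show "norm (f y - f x - L (y - x)) / norm (y - x) \<le> K * norm (y - x)"
    if "y \<noteq> x" "dist y x < 1" for y
    using K[of "y - x"] that by (simp add: divide_simps dist_norm power2_eq_square mult_ac)
  show "((\<lambda>y. K * norm (y - x)) \<longlongrightarrow> 0) (at x)"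
    by (auto intro!: tendsto_eq_intros)
qed (use assms in auto)

text \<open>Continuity with its witnesses fixed, so that all later bounds involve the same c and d.
  The sign of c allows inequalities between seminorms to be multiplied by it.\<close>

locale schwartz_functional =
  fixes u :: "(real ^ 'n::finite \<Rightarrow> complex) \<Rightarrow> complex" and d :: nat and c :: real
  assumes lincomb: "\<phi> \<in> schwartz \<Longrightarrow> \<psi> \<in> schwartz \<Longrightarrow> u (\<lambda>x. a * \<phi> x + b * \<psi> x) = a * u \<phi> + b * u \<psi>"
    and seminorm_bound: "\<psi> \<in> schwartz \<Longrightarrow> norm (u \<psi>) \<le> c * schwartz_seminorm d \<psi>"
    and c_nonneg: "0 \<le> c"
begin

lemma reflect:
  assumes "\<phi> \<in> schwartz"
  shows "(\<lambda>y. \<phi> (x - y)) \<in> schwartz"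
    and "norm (iter_partial is (\<lambda>y. \<phi> (x - y)) y) = norm (iter_partial is \<phi> (x - y))"
proof -
  show "(\<lambda>y. \<phi> (x - y)) \<in> schwartz"
    using schwartz_affine[OF assms, of "-1" 1 x] by simp
  show "norm (iter_partial is (\<lambda>y. \<phi> (x - y)) y) = norm (iter_partial is \<phi> (x - y))"
    using iter_partial_affine[OF schwartz_smooth[OF assms], of "is" 1 "-1" x]
    by (simp add: norm_mult norm_power)
qed

text \<open>The functional acts on y -> \<open>\<phi> (x - y)\<close>. Splitting the weight (1 +
  |y|)^d between x - y and x shows that the convolution grows at most like the d-th power of 1 +
  |x|.\<close>

lemma convolution_bound:
  assumes "\<phi> \<in> schwartz"
    and B: "\<And>is z. length is \<le> d \<Longrightarrow> norm (iter_partial is \<phi> z) * (1 + norm z) ^ d \<le> B"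
  shows "norm (convolution \<phi> u x) \<le> c * B * (1 + norm x) ^ d"
proof -
  have "schwartz_seminorm d (\<lambda>y. \<phi> (x - y)) \<le> B * (1 + norm x) ^ d"
  proof (rule schwartz_seminorm_le)
    fix "is" :: "'n list" and y assume l: "length is \<le> d"
    have "1 + norm y \<le> (1 + norm (x - y)) * (1 + norm x)"
      using one_plus_norm_add_le[of "y - x" x] by (simp add: norm_minus_commute)
    hence "norm (iter_partial is \<phi> (x - y)) * (1 + norm y) ^ d
        \<le> norm (iter_partial is \<phi> (x - y)) * ((1 + norm (x - y)) * (1 + norm x)) ^ d"
      by (intro mult_left_mono power_mono) auto
    also have "\<dots> = (norm (iter_partial is \<phi> (x - y)) * (1 + norm (x - y)) ^ d) * (1 + norm x) ^ d"
      by (simp add: power_mult_distrib)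
    also have "\<dots> \<le> B * (1 + norm x) ^ d"
      by (intro mult_right_mono B l) auto
    finally show "norm (iter_partial is (\<lambda>y. \<phi> (x - y)) y) * (1 + norm y) ^ d \<le> B * (1 + norm x) ^ d"
      by (simp add: reflect assms)
  qed
  hence "c * schwartz_seminorm d (\<lambda>y. \<phi> (x - y)) \<le> c * (B * (1 + norm x) ^ d)"
    by (intro mult_left_mono c_nonneg)
  thus ?thesis
    using seminorm_bound[OF reflect(1)[OF assms(1)], of x] by (simp add: convolution_def mult_ac)
qed

lemma convolution_lincomb:
  "\<phi> \<in> schwartz \<Longrightarrow> \<psi> \<in> schwartz \<Longrightarrow>
    convolution (\<lambda>x. a * \<phi> x + b * \<psi> x) u x = a * convolution \<phi> u x + b * convolution \<psi> u x"
  unfolding convolution_def by (rule lincomb) (auto intro: reflect)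

lemma convolution_sum:
  assumes "finite A" "\<And>i. i \<in> A \<Longrightarrow> f i \<in> schwartz"
  shows "convolution (\<lambda>x. \<Sum>i\<in>A. a i * f i x) u x = (\<Sum>i\<in>A. a i * convolution (f i) u x)"
  using assms
proof (induction A rule: finite_induct)
  case empty
  have "(\<lambda>x. 0) \<in> schwartz" using schwartz_sum[of "{}"] by fastforce
  from convolution_lincomb[OF this this, of 0 0] show ?case by simp
next
  case (insert i A)
  have "convolution (\<lambda>x. a i * f i x + 1 * (\<Sum>i\<in>A. a i * f i x)) u x
      = a i * convolution (f i) u x + 1 * convolution (\<lambda>x. \<Sum>i\<in>A. a i * f i x) u x"
    by (intro convolution_lincomb schwartz_sum) (use insert in auto)
  thus ?case using insert by simp
qed

text \<open>By linearity the error of the first-order expansion is itself a convolution, with the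
  Taylor remainder of \<open>\<phi>\<close> in place of \<open>\<phi>\<close>. It then suffices that
  this remainder is quadratically small in the seminorm of index d.\<close>

lemma has_derivative_convolution:
  assumes \<phi>: "\<phi> \<in> schwartz"
  shows "(convolution \<phi> u has_derivative
    (\<lambda>h. \<Sum>i\<in>UNIV. (h $ i) *\<^sub>R convolution (partial i \<phi>) u x)) (at x)"
proof -
  \<comment> \<open>Two derivatives beyond the d of the seminorm occur in the first-order remainder,
    whence the index d + 2.\<close>
  define B where "B = real CARD('n) * real CARD('n) * schwartz_seminorm (d + 2) \<phi>"
  have "B \<ge> 0" using schwartz_seminorm_nonneg[OF \<phi>] by (simp add: B_def)
  show ?thesis
  proof (rule has_derivative_quadraticI[where K = "c * (B * 2 ^ d) * (1 + norm x) ^ d"])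
    show "bounded_linear (\<lambda>h. \<Sum>i\<in>UNIV. (h $ i) *\<^sub>R convolution (partial i \<phi>) u x)"
      by (intro bounded_linear_sum bounded_linear_scaleR_const bounded_linear_vec_nth)
    fix h :: "real ^ 'n" assume h: "norm h \<le> 1"
    define s where "s = (\<lambda>z. \<phi> (z + h))"
    define L where "L = (\<lambda>z. \<Sum>i\<in>UNIV. of_real (h $ i) * partial i \<phi> z)"
    \<comment> \<open>The coefficients 1 and -1 are kept visible to match the shape of the linearity
      assumption.\<close>
    define dif where "dif = (\<lambda>z. 1 * s z + (-1) * \<phi> z)"
    define r where "r = (\<lambda>z. 1 * dif z + (-1) * L z)"
    have s: "s \<in> schwartz"
      using schwartz_affine[OF \<phi>, of 1 1 h] by (simp add: s_def)
    have L: "L \<in> schwartz"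
      unfolding L_def by (intro schwartz_sum schwartz_partial \<phi>) auto
    have dif: "dif \<in> schwartz" unfolding dif_def by (intro schwartz_lincomb s \<phi>)
    have r: "r \<in> schwartz" unfolding r_def by (intro schwartz_lincomb dif L)
    have "convolution r u x = convolution dif u x - convolution L u x"
      unfolding r_def using convolution_lincomb[OF dif L, of 1 "-1" x] by simp
    also have "convolution dif u x = convolution s u x - convolution \<phi> u x"
      unfolding dif_def using convolution_lincomb[OF s \<phi>, of 1 "-1" x] by simp
    also have "convolution s u x = convolution \<phi> u (x + h)"
      by (simp add: convolution_def s_def algebra_simps)
    also have "convolution L u x = (\<Sum>i\<in>UNIV. (h $ i) *\<^sub>R convolution (partial i \<phi>) u x)"
      unfolding L_def scaleR_conv_of_real by (intro convolution_sum schwartz_partial \<phi>) auto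
    finally have eq: "convolution \<phi> u (x + h) - convolution \<phi> u x
        - (\<Sum>i\<in>UNIV. (h $ i) *\<^sub>R convolution (partial i \<phi>) u x) = convolution r u x" ..
    have "norm (convolution r u x) \<le> c * (B * norm h ^ 2 * 2 ^ d) * (1 + norm x) ^ d"
    proof (rule convolution_bound[OF r])
      fix "is" :: "'n list" and z assume l: "length is \<le> d"
      let ?f = "iter_partial is \<phi>"
      have "iter_partial is r z = iter_partial is dif z - iter_partial is L z"
        unfolding r_def using dif L by (subst iter_partial_lincomb) (auto intro: schwartz_smooth)
      also have "iter_partial is dif z = iter_partial is s z - ?f z"
        unfolding dif_def using s \<phi> by (subst iter_partial_lincomb) (auto intro: schwartz_smooth)
      also have "iter_partial is s z = ?f (z + h)"
        using iter_partial_affine[OF schwartz_smooth[OF \<phi>], of "is" 1 1 h] by (simp add: s_def)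
      also have "iter_partial is L z = (\<Sum>i\<in>UNIV. of_real (h $ i) * iter_partial is (partial i \<phi>) z)"
        unfolding L_def
        using iter_partial_sum[of UNIV "\<lambda>i. partial i \<phi>" "\<lambda>i. of_real (h $ i)" "is"] schwartz_smooth[OF \<phi>]
        by (simp add: smooth_partial)
      also have "\<dots> = (\<Sum>i\<in>UNIV. (h $ i) *\<^sub>R partial i ?f z)"
        by (simp add: iter_partial_partial_swap schwartz_smooth \<phi> scaleR_conv_of_real)
      finally have "norm (iter_partial is r z) * (1 + norm z) ^ d
          = norm (?f (z + h) - ?f z - (\<Sum>i\<in>UNIV. (h $ i) *\<^sub>R partial i ?f z)) * (1 + norm z) ^ d"
        by simp
      also have "\<dots> \<le> (real CARD('n) * real CARD('n) * schwartz_seminorm (d + 2) \<phi>) * norm h ^ 2 * (1 + norm h) ^ d"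
      proof (rule first_order_remainder_bound)
        fix i j w
        \<comment> \<open>The seminorm uses one index for the number of derivatives and for the
          weight, so the weight is raised along with the order.\<close>
        have "norm (partial j (partial i ?f) w) * (1 + norm w) ^ d
            \<le> norm (iter_partial (j # i # is) \<phi> w) * (1 + norm w) ^ (d + 2)"
          by (intro mult_mono power_increasing) auto
        also have "\<dots> \<le> schwartz_seminorm (d + 2) \<phi>"
          by (rule le_schwartz_seminorm[OF \<phi>]) (use l in simp)
        finally show "norm (partial j (partial i ?f) w) * (1 + norm w) ^ d \<le> schwartz_seminorm (d + 2) \<phi>" .
      qed (use \<phi> in \<open>auto intro: smooth_iter_partial schwartz_smooth\<close>)
      also have "\<dots> \<le> B * norm h ^ 2 * 2 ^ d"
        unfolding B_def using h schwartz_seminorm_nonneg[OF \<phi>]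
        by (intro mult_mono power_mono) auto
      finally show "norm (iter_partial is r z) * (1 + norm z) ^ d \<le> B * norm h ^ 2 * 2 ^ d" .
    qed
    thus "norm (convolution \<phi> u (x + h) - convolution \<phi> u x
        - (\<Sum>i\<in>UNIV. (h $ i) *\<^sub>R convolution (partial i \<phi>) u x))
        \<le> c * (B * 2 ^ d) * (1 + norm x) ^ d * norm h ^ 2"
      unfolding eq by (simp add: mult_ac)
  qed
qed

lemma partial_convolution:
  assumes "\<phi> \<in> schwartz"
  shows "partial i (convolution \<phi> u) = convolution (partial i \<phi>) u"
  using partial_eqI[OF has_derivative_convolution[OF assms], of i]
  by (auto simp: axis_def if_distrib[of "\<lambda>x. x *\<^sub>R _"] cong: if_cong)

lemma iter_partial_convolution:
  "\<phi> \<in> schwartz \<Longrightarrow> iter_partial is (convolution \<phi> u) = convolution (iter_partial is \<phi>) u"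
  by (induction "is") (auto simp: partial_convolution schwartz_iter_partial)

lemma smooth_convolution:
  assumes "\<phi> \<in> schwartz"
  shows "smooth (convolution \<phi> u)"
proof (rule smooth_coinduct[of _ "{convolution \<phi> u | \<phi>. \<phi> \<in> schwartz}"])
  show "g differentiable_on UNIV" if "g \<in> {convolution \<phi> u | \<phi>. \<phi> \<in> schwartz}" for g
    using that has_derivative_convolution by (fastforce simp: differentiable_on_def differentiable_def)
qed (use assms partial_convolution schwartz_partial in blast)+

lemma schwartz_dilation:
  fixes \<Phi> :: "real ^ 'n \<Rightarrow> complex"
  assumes "\<Phi> \<in> schwartz" "t > 0"
  shows "dilation \<Phi> t \<in> schwartz"
  using schwartz_affine[OF assms(1), of t "of_real (t ^ CARD('n))" 0] assms(2)
  by (simp add: dilation_def[abs_def])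

text \<open>The factor \<open>max 1 (1 / t) ^ d\<close> comes from rescaling the weight,
  \<open>max 1 t ^ d\<close> from the at most d derivatives inside the seminorm. Both are kept
  because temperedness is demanded for every t > 0; for t \<le> 1 what remains is t^(n + k - d),
  with k the length of \<open>is\<close>.\<close>

lemma convolution_dilation_bound:
  fixes \<Phi> :: "real ^ 'n \<Rightarrow> complex"
  assumes \<Phi>: "\<Phi> \<in> schwartz" and "t > 0"
  shows "norm (iter_partial is (convolution (dilation \<Phi> t) u) x)
    \<le> c * (schwartz_seminorm (d + length is) \<Phi> *
        (t ^ (CARD('n) + length is) * max 1 (1 / t) ^ d * max 1 t ^ d)) * (1 + norm x) ^ d"
  unfolding iter_partial_convolution[OF schwartz_dilation[OF assms]]
proof (rule convolution_bound[OF schwartz_iter_partial[OF schwartz_dilation[OF assms]]])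
  fix js :: "'n list" and z :: "real ^ 'n" assume js: "length js \<le> d"
  let ?w = "t *\<^sub>R z" and ?p = "schwartz_seminorm (d + length is) \<Phi>"
  have "iter_partial (js @ is) (dilation \<Phi> t)
      = (\<lambda>x. (of_real (t ^ CARD('n)) * of_real t ^ length (js @ is)) * iter_partial (js @ is) \<Phi> (t *\<^sub>R x))"
    using iter_partial_affine[OF schwartz_smooth[OF \<Phi>], of "js @ is" "of_real (t ^ CARD('n))" t 0]
    by (simp add: dilation_def[abs_def])
  hence "norm (iter_partial js (iter_partial is (dilation \<Phi> t)) z)
      = t ^ CARD('n) * t ^ (length js + length is) * norm (iter_partial (js @ is) \<Phi> ?w)"
    using \<open>t > 0\<close> by (simp add: norm_mult norm_power iter_partial_append)
  also have "\<dots> = t ^ (CARD('n) + length is) * t ^ length js * norm (iter_partial (js @ is) \<Phi> ?w)"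
    by (simp add: power_add)
  finally have eq: "norm (iter_partial js (iter_partial is (dilation \<Phi> t)) z)
      = t ^ (CARD('n) + length is) * t ^ length js * norm (iter_partial (js @ is) \<Phi> ?w)" .
  \<comment> \<open>With w = t z one has |z| = |w| / t; the maximum with 1 also covers the constant
    term of the weight.\<close>
  have "1 + norm z \<le> max 1 (1 / t) * (1 + norm ?w)"
  proof -
    have "1 \<le> max 1 (1 / t) * 1" "norm z \<le> max 1 (1 / t) * norm ?w"
      using \<open>t > 0\<close> mult_right_mono[of "1 / t" "max 1 (1 / t)" "norm ?w"] by auto
    thus ?thesis unfolding distrib_left by linarith
  qed
  hence z: "(1 + norm z) ^ d \<le> max 1 (1 / t) ^ d * (1 + norm ?w) ^ d"
    unfolding power_mult_distrib[symmetric] by (intro power_mono) auto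
  have "t ^ length js \<le> max 1 t ^ length js" using \<open>t > 0\<close> by (intro power_mono) auto
  also have "\<dots> \<le> max 1 t ^ d" using js by (intro power_increasing) auto
  finally have t: "t ^ length js \<le> max 1 t ^ d" .
  have "norm (iter_partial js (iter_partial is (dilation \<Phi> t)) z) * (1 + norm z) ^ d
      \<le> (t ^ (CARD('n) + length is) * max 1 t ^ d * norm (iter_partial (js @ is) \<Phi> ?w))
         * (max 1 (1 / t) ^ d * (1 + norm ?w) ^ d)"
    unfolding eq using \<open>t > 0\<close> by (intro mult_mono mult_left_mono mult_right_mono z t) auto
  also have "\<dots> = (t ^ (CARD('n) + length is) * max 1 (1 / t) ^ d * max 1 t ^ d)
      * (norm (iter_partial (js @ is) \<Phi> ?w) * (1 + norm ?w) ^ d)"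
    by (simp add: mult_ac)
  also have "\<dots> \<le> (t ^ (CARD('n) + length is) * max 1 (1 / t) ^ d * max 1 t ^ d) * ?p"
  proof (rule mult_left_mono)
    have "norm (iter_partial (js @ is) \<Phi> ?w) * (1 + norm ?w) ^ d
        \<le> norm (iter_partial (js @ is) \<Phi> ?w) * (1 + norm ?w) ^ (d + length is)"
      by (intro mult_left_mono power_increasing) auto
    also have "\<dots> \<le> ?p" by (rule le_schwartz_seminorm[OF \<Phi>]) (use js in simp)
    finally show "norm (iter_partial (js @ is) \<Phi> ?w) * (1 + norm ?w) ^ d \<le> ?p" .
  qed (use \<open>t > 0\<close> in auto)
  finally show "norm (iter_partial js (iter_partial is (dilation \<Phi> t)) z) * (1 + norm z) ^ d
      \<le> ?p * (t ^ (CARD('n) + length is) * max 1 (1 / t) ^ d * max 1 t ^ d)"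
    by (simp add: mult_ac)
qed

end

section \<open>Taylor remainders\<close>

lemma has_derivative_mi_power:
  fixes x :: "real ^ 'n::finite"
  shows "((\<lambda>x. mi_power x \<alpha>) has_derivative
    (\<lambda>h. \<Sum>i\<in>UNIV. (real (\<alpha> i) * (x $ i) ^ (\<alpha> i - 1) * h $ i) * (\<Prod>j\<in>UNIV - {i}. (x $ j) ^ \<alpha> j))) (at x)"
  unfolding mi_power_def
proof (rule has_derivative_prod)
  fix i
  have "((\<lambda>x. x $ i) has_derivative (\<lambda>h. h $ i)) (at x)"
    by (intro bounded_linear_imp_has_derivative bounded_linear_vec_nth)
  from has_derivative_power[OF this, of "\<alpha> i"]
  show "((\<lambda>x. (x $ i) ^ \<alpha> i) has_derivative (\<lambda>h. real (\<alpha> i) * (x $ i) ^ (\<alpha> i - 1) * h $ i)) (at x)"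
    by (simp add: mult_ac)
qed

text \<open>If \<open>\<alpha> k = 0\<close>, the truncated exponent on the right is harmless, since
  the factor in front of it vanishes.\<close>

lemma mi_power_derivative_axis:
  "(\<Sum>i\<in>UNIV. (real (\<alpha> i) * (x $ i) ^ (\<alpha> i - 1) * (axis k 1 :: real ^ 'n::finite) $ i) * (\<Prod>j\<in>UNIV - {i}. (x $ j) ^ \<alpha> j))
    = real (\<alpha> k) * mi_power x (\<alpha>(k := \<alpha> k - 1))"
proof -
  have "mi_power x (\<alpha>(k := \<alpha> k - 1)) = (x $ k) ^ (\<alpha> k - 1) * (\<Prod>j\<in>UNIV - {k}. (x $ j) ^ \<alpha> j)"
    unfolding mi_power_def by (subst prod.remove[of UNIV k]) auto
  thus ?thesis
    by (simp add: axis_def if_distrib[of "\<lambda>x. _ * x"] if_distrib[of "\<lambda>x. x * _"] mult.assoc cong: if_cong)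
qed

lemma continuous_mi_power: "continuous_on UNIV (\<lambda>x. mi_power x \<alpha>)"
  unfolding mi_power_def by (intro continuous_intros)

lemma mi_size_Suc: "mi_size (\<alpha>(i := Suc (\<alpha> i))) = Suc (mi_size \<alpha>)"
  unfolding mi_size_def by (subst (1 2) sum.remove[of UNIV i]) auto

lemma mi_fact_Suc: "mi_fact (\<alpha>(i := Suc (\<alpha> i))) = real (Suc (\<alpha> i)) * mi_fact \<alpha>"
  unfolding mi_fact_def by (subst (1 2) prod.remove[of UNIV i]) (auto simp: algebra_simps)

lemma mi_fact_nonzero: "mi_fact \<alpha> \<noteq> 0"
  by (simp add: mi_fact_def)

lemma mi_partial_Suc:
  assumes "smooth g"
  shows "mi_partial (\<alpha>(i := Suc (\<alpha> i))) g = mi_partial \<alpha> (partial i g)"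
  unfolding mi_partial_eq_iter_partial[of \<alpha>] iter_partial_partial
  by (rule mi_partial_eqI[OF assms]) (simp add: count_mi_list)

text \<open>Raising the i-th entry is a bijection onto the multi-indices with positive i-th entry.
  As the bound is an integer, the case m = 0 is included, with an empty sum on the right.\<close>

lemma sum_mi_upto_shift:
  assumes "\<And>\<alpha>. \<alpha> i = 0 \<Longrightarrow> F \<alpha> = 0"
  shows "(\<Sum>\<alpha>\<in>mi_upto m. F \<alpha>) = (\<Sum>\<alpha>\<in>mi_upto (m - 1). F (\<alpha>(i := Suc (\<alpha> i))))"
proof -
  have "(\<Sum>\<alpha>\<in>mi_upto m. F \<alpha>) = (\<Sum>\<alpha>\<in>{\<alpha>\<in>mi_upto m. \<alpha> i > 0}. F \<alpha>)"
    by (rule sum.mono_neutral_right) (auto simp: finite_mi_upto assms)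
  also have "\<dots> = (\<Sum>\<alpha>\<in>mi_upto (m - 1). F (\<alpha>(i := Suc (\<alpha> i))))"
  proof (rule sum.reindex_bij_witness[of _ "\<lambda>\<alpha>. \<alpha>(i := Suc (\<alpha> i))" "\<lambda>\<alpha>. \<alpha>(i := \<alpha> i - 1)"])
    fix \<alpha> assume a: "\<alpha> \<in> {\<alpha> \<in> mi_upto m. 0 < \<alpha> i}"
    hence eq: "(\<alpha>(i := \<alpha> i - 1))(i := Suc ((\<alpha>(i := \<alpha> i - 1)) i)) = \<alpha>" by auto
    thus "(\<alpha>(i := \<alpha> i - 1))(i := Suc ((\<alpha>(i := \<alpha> i - 1)) i)) = \<alpha>" .
    have "mi_size \<alpha> = Suc (mi_size (\<alpha>(i := \<alpha> i - 1)))"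
      using mi_size_Suc[of "\<alpha>(i := \<alpha> i - 1)" i] unfolding eq .
    thus "\<alpha>(i := \<alpha> i - 1) \<in> mi_upto (m - 1)" using a by (simp add: mi_upto_def)
    show "F ((\<alpha>(i := \<alpha> i - 1))(i := Suc ((\<alpha>(i := \<alpha> i - 1)) i))) = F \<alpha>" unfolding eq ..
  qed (auto simp: mi_upto_def mi_size_Suc)
  finally show ?thesis .
qed

text \<open>Differentiating a power cancels one factor of the factorial, and the remaining
  coefficient is a derivative of \<open>partial i g\<close> because smoothness permits
  reordering.\<close>

lemma taylor_poly_derivative:
  fixes g :: "real ^ 'n::finite \<Rightarrow> complex"
  assumes "smooth g"
  shows "taylor_poly g m differentiable_on UNIV"
    and "partial i (taylor_poly g m) = taylor_poly (partial i g) (m - 1)"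
proof -
  let ?D = "\<lambda>\<alpha> x h. \<Sum>i\<in>UNIV. (real (\<alpha> i) * (x $ i) ^ (\<alpha> i - 1) * h $ i) * (\<Prod>j\<in>UNIV - {i}. (x $ j) ^ \<alpha> j)"
  have der: "(taylor_poly g m has_derivative
      (\<lambda>h. \<Sum>\<alpha>\<in>mi_upto m. mi_partial \<alpha> g 0 * of_real (?D \<alpha> x h / mi_fact \<alpha>))) (at x)" for x
    unfolding taylor_poly_def taylor_term_def
    by (intro has_derivative_sum has_derivative_mult_right has_derivative_of_real
        bounded_linear.has_derivative[OF bounded_linear_divide has_derivative_mi_power])
  thus "taylor_poly g m differentiable_on UNIV"
    by (auto simp: differentiable_on_def differentiable_def)
  show "partial i (taylor_poly g m) = taylor_poly (partial i g) (m - 1)"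
  proof
    fix x
    have "partial i (taylor_poly g m) x = (\<Sum>\<alpha>\<in>mi_upto m. mi_partial \<alpha> g 0 *
        of_real (real (\<alpha> i) * mi_power x (\<alpha>(i := \<alpha> i - 1)) / mi_fact \<alpha>))"
      unfolding partial_eqI[OF der] mi_power_derivative_axis ..
    also have "\<dots> = (\<Sum>\<alpha>\<in>mi_upto (m - 1). mi_partial (\<alpha>(i := Suc (\<alpha> i))) g 0 *
        of_real (real (Suc (\<alpha> i)) * mi_power x \<alpha> / mi_fact (\<alpha>(i := Suc (\<alpha> i)))))"
      by (subst sum_mi_upto_shift[where i = i]) auto
    also have "\<dots> = taylor_poly (partial i g) (m - 1) x"
      unfolding taylor_poly_def taylor_term_def mi_partial_Suc[OF assms] mi_fact_Suc
      by (intro sum.cong refl) (simp del: of_nat_Suc)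
    finally show "partial i (taylor_poly g m) x = taylor_poly (partial i g) (m - 1) x" .
  qed
qed

lemma taylor_poly_at_0:
  fixes g :: "real ^ 'n::finite \<Rightarrow> complex"
  assumes "m \<ge> 0"
  shows "taylor_poly g m 0 = g 0"
proof -
  have z: "mi_power 0 \<alpha> = (if \<alpha> = (\<lambda>_. 0) then 1 else 0)" for \<alpha> :: "'n \<Rightarrow> nat"
  proof -
    have "\<exists>i. \<alpha> i \<noteq> 0" if "\<alpha> \<noteq> (\<lambda>_. 0)" using that by auto
    thus ?thesis by (auto simp: mi_power_def)
  qed
  have [simp]: "mi_partial (\<lambda>_. 0) g = g"
  proof -
    have "foldr (\<lambda>i g. g) is g = g" for "is" :: "'n list" by (induction "is") auto
    thus ?thesis by (simp add: mi_partial_def)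
  qed
  have "taylor_poly g m 0 = (\<Sum>\<alpha>\<in>mi_upto m. if \<alpha> = (\<lambda>_ :: 'n. 0) then g 0 else 0)"
    unfolding taylor_poly_def taylor_term_def
    by (intro sum.cong refl) (auto simp: z mi_fact_def)
  also have "\<dots> = g 0"
  proof -
    have "(\<lambda>_ :: 'n. 0) \<in> mi_upto m" using assms by (simp add: mi_upto_def mi_size_def)
    thus ?thesis by (simp add: finite_mi_upto)
  qed
  finally show ?thesis .
qed

text \<open>Induction on the order replaces an integral formula: each partial derivative of the
  remainder is the remainder of \<open>partial i g\<close> one degree lower, and the remainder
  vanishes at 0. The induction starts at degree -1, where the remainder is g itself.\<close>

lemma taylor_remainder_bound:
  fixes g :: "real ^ 'n::finite \<Rightarrow> complex"
  assumes "smooth g" "0 \<le> B"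
    and "\<And>is x. length is = k \<Longrightarrow> norm (iter_partial is g x) \<le> B * (1 + norm x) ^ N"
  shows "norm (taylor_remainder g (int k - 1) x) \<le> (real CARD('n) ^ k * B) * norm x ^ k * (1 + norm x) ^ N"
  using assms
proof (induction k arbitrary: g x)
  case 0
  have "taylor_remainder g (int 0 - 1) x = g x"
    by (simp add: taylor_remainder_def taylor_poly_def mi_upto_def)
  thus ?case using 0(3)[of "[]" x] by simp
next
  case (Suc k)
  have diff: "g differentiable_on UNIV" "taylor_poly g (int k) differentiable_on UNIV"
    using Suc.prems(1) by (auto intro: smooth_differentiable taylor_poly_derivative)
  have rem: "taylor_remainder g (int k) = (\<lambda>x. 1 * g x + (-1) * taylor_poly g (int k) x)"
    by (auto simp: taylor_remainder_def)
  have par: "partial i (taylor_remainder g (int k)) = taylor_remainder (partial i g) (int k - 1)" for i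
    unfolding rem partial_lincomb[OF diff] taylor_poly_derivative(2)[OF Suc.prems(1)]
    by (auto simp: taylor_remainder_def)
  have "norm (taylor_remainder g (int k) x)
      \<le> (real CARD('n) * (real CARD('n) ^ k * B)) * norm x ^ Suc k * (1 + norm x) ^ N"
  proof (rule gradient_growth_bound)
    show "taylor_remainder g (int k) differentiable_on UNIV"
      unfolding rem by (rule differentiable_lincomb[OF diff])
    show "taylor_remainder g (int k) 0 = 0"
      by (simp add: taylor_remainder_def taylor_poly_at_0)
    show "norm (partial i (taylor_remainder g (int k)) y)
        \<le> real CARD('n) ^ k * B * norm y ^ k * (1 + norm y) ^ N" for i y
      unfolding par
      by (rule Suc.IH) (use Suc.prems in \<open>auto intro: smooth_partial simp: iter_partial_partial\<close>)
  qed (use \<open>0 \<le> B\<close> in auto)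
  thus ?case by (simp add: mult_ac)
qed

section \<open>Functions of polynomial growth\<close>

lemma Basis_real_vec: "(Basis :: (real ^ 'n::finite) set) = range (\<lambda>i. axis i 1)"
  by (auto simp: Basis_vec_def)

text \<open>Fubini for products of one-variable functions. As \<open>lborel\<close> is the image of
  a product measure indexed by \<open>Basis\<close>, the factors are first reindexed from
  coordinates to basis vectors by k.\<close>

lemma lborel_integral_prod_vec:
  fixes h :: "'n::finite \<Rightarrow> real \<Rightarrow> 'b::{real_normed_field,banach,second_countable_topology}"
  assumes h: "\<And>i. integrable lborel (h i)"
  shows "integrable lborel (\<lambda>x :: real ^ 'n. \<Prod>i\<in>UNIV. h i (x $ i))"
    and "(LINT x|lborel. (\<Prod>i\<in>UNIV. h i ((x :: real ^ 'n) $ i))) = (\<Prod>i\<in>UNIV. LINT y|lborel. h i y)"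
proof -
  let ?ax = "\<lambda>i. axis i 1 :: real ^ 'n"
  have inj: "inj ?ax" by (auto simp: inj_def axis_eq_axis)
  define k where "k b = h (inv ?ax b)" for b
  have k: "k (?ax i) = h i" for i by (simp add: k_def inv_f_f[OF inj])
  let ?P = "\<lambda>x :: real ^ 'n. \<Prod>i\<in>UNIV. h i (x $ i)"
  interpret product_sigma_finite "\<lambda>_ :: real ^ 'n. lborel :: real measure"
    by standard
  have meas[measurable]: "h i \<in> borel_measurable borel" for i
    using borel_measurable_integrable[OF h[of i]] by simp
  have P[measurable]: "?P \<in> borel_measurable borel" by measurable
  have k_int: "b \<in> Basis \<Longrightarrow> integrable lborel (k b)" for b by (simp add: k_def h)
  have eq: "?P (\<Sum>b\<in>Basis. f b *\<^sub>R b) = (\<Prod>b\<in>Basis. k b (f b))" for f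
  proof -
    have "(\<Sum>b\<in>Basis. f b *\<^sub>R b) $ i = f (?ax i)" for i
    proof -
      have "(\<Sum>b\<in>Basis. f b *\<^sub>R b) = (\<Sum>j\<in>UNIV. f (?ax j) *\<^sub>R ?ax j)"
        unfolding Basis_real_vec by (subst sum.reindex[OF inj]) (simp add: o_def)
      thus ?thesis
        by (simp add: axis_def if_distrib[of "\<lambda>x. _ * x"] cong: if_cong)
    qed
    hence "?P (\<Sum>b\<in>Basis. f b *\<^sub>R b) = (\<Prod>i\<in>UNIV. k (?ax i) (f (?ax i)))" by (simp add: k)
    also have "\<dots> = (\<Prod>b\<in>Basis. k b (f b))"
      unfolding Basis_real_vec by (subst prod.reindex[OF inj]) (simp add: o_def)
    finally show ?thesis .
  qed
  have T[measurable]: "(\<lambda>f. \<Sum>b\<in>Basis. f b *\<^sub>R b) \<in> (\<Pi>\<^sub>M b\<in>Basis. lborel) \<rightarrow>\<^sub>M (borel :: (real ^ 'n) measure)"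
    by measurable
  show "integrable lborel ?P"
    unfolding lborel_eq[where 'a = "real ^ 'n"]
    by (subst integrable_distr_eq[OF T P], unfold eq)
       (rule product_integrable_prod[OF finite_Basis k_int])
  have "(LINT x|lborel. ?P x) = (LINT f|(\<Pi>\<^sub>M b\<in>Basis. lborel). (\<Prod>b\<in>Basis. k b (f b)))"
    unfolding lborel_eq[where 'a = "real ^ 'n"] by (subst integral_distr[OF T P], unfold eq) (rule refl)
  also have "\<dots> = (\<Prod>b\<in>Basis. LINT y|lborel. k b y)"
    by (rule product_integral_prod[OF finite_Basis k_int])
  also have "\<dots> = (\<Prod>i\<in>UNIV. LINT y|lborel. h i y)"
    unfolding Basis_real_vec by (subst prod.reindex[OF inj]) (simp add: o_def k)
  finally show "(LINT x|lborel. ?P x) = (\<Prod>i\<in>UNIV. LINT y|lborel. h i y)" .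
qed

lemma integrable_inverse_one_plus_square: "integrable lborel (\<lambda>x :: real. inverse (1 + x\<^sup>2))"
  using integrable_inverse_1_plus_square by (simp add: set_integrable_def einterval_def)

text \<open>Two powers of the weight per coordinate dominate the product of the factors 1 + x_i^2,
  whose inverse is integrable factor by factor.\<close>

lemma integrable_inverse_growth:
  "integrable lborel (\<lambda>x :: real ^ 'n::finite. inverse ((1 + norm x) ^ (2 * CARD('n))))"
proof (rule Bochner_Integration.integrable_bound)
  show "integrable lborel (\<lambda>x :: real ^ 'n. \<Prod>i\<in>UNIV. inverse (1 + (x $ i)\<^sup>2))"
    by (intro lborel_integral_prod_vec integrable_inverse_one_plus_square)
  show "AE x in lborel. norm (inverse ((1 + norm (x :: real ^ 'n)) ^ (2 * CARD('n))))
      \<le> norm (\<Prod>i\<in>UNIV. inverse (1 + (x $ i)\<^sup>2))"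
  proof (rule AE_I2)
    fix x :: "real ^ 'n"
    have "(\<Prod>i\<in>UNIV. 1 + (x $ i)\<^sup>2) \<le> (\<Prod>i\<in>(UNIV::'n set). (1 + norm x)\<^sup>2)"
    proof (rule prod_mono)
      fix i
      have "(x $ i)\<^sup>2 \<le> (norm x)\<^sup>2"
        using component_le_norm_cart[of x i] by (metis abs_ge_zero power2_abs power_mono)
      moreover have "(1 + norm x)\<^sup>2 = 1 + 2 * norm x + (norm x)\<^sup>2"
        by (simp add: power2_eq_square algebra_simps)
      ultimately have "1 + (x $ i)\<^sup>2 \<le> (1 + norm x)\<^sup>2"
        using norm_ge_zero[of x] by linarith
      thus "0 \<le> 1 + (x $ i)\<^sup>2 \<and> 1 + (x $ i)\<^sup>2 \<le> (1 + norm x)\<^sup>2"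
        by simp
    qed
    hence le: "(\<Prod>i\<in>UNIV. 1 + (x $ i)\<^sup>2) \<le> (1 + norm x) ^ (2 * CARD('n))"
      by (simp add: power_mult)
    have pos: "0 < (\<Prod>i\<in>UNIV. 1 + (x $ i)\<^sup>2)"
      by (intro prod_pos) (smt (verit) zero_le_power2)
    have "inverse ((1 + norm x) ^ (2 * CARD('n))) \<le> inverse (\<Prod>i\<in>UNIV. 1 + (x $ i)\<^sup>2)"
      by (rule le_imp_inverse_le[OF le pos])
    also have "\<dots> = (\<Prod>i\<in>UNIV. inverse (1 + (x $ i)\<^sup>2))"
      by (rule prod_inversef[unfolded o_def, symmetric])
    finally show "norm (inverse ((1 + norm x) ^ (2 * CARD('n)))) \<le> norm (\<Prod>i\<in>UNIV. inverse (1 + (x $ i)\<^sup>2))"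
      by simp
  qed
qed simp

text \<open>In the index N + 2 n, the part N absorbs the growth of g and 2 n provides integrability.
  The constant C stands as a separate factor so that a family depending on t can carry its whole
  dependence there.\<close>

lemma growth_schwartz_integral:
  fixes g :: "real ^ 'n::finite \<Rightarrow> complex"
  assumes g: "continuous_on UNIV g" "\<And>x. norm (g x) \<le> C * (1 + norm x) ^ N" and \<psi>: "\<psi> \<in> schwartz"
  shows "integrable lborel (\<lambda>x. g x * \<psi> x)"
    and "norm (fun_distribution g \<psi>) \<le> C * ((LINT x|lborel. inverse ((1 + norm (x :: real ^ 'n)) ^ (2 * CARD('n))))
      * schwartz_seminorm (N + 2 * CARD('n)) \<psi>)"
proof -
  let ?p = "schwartz_seminorm (N + 2 * CARD('n)) \<psi>"
  let ?w = "\<lambda>x :: real ^ 'n. inverse ((1 + norm x) ^ (2 * CARD('n)))"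
  have pos: "(1 + norm x) > 0" for x :: "real ^ 'n" using norm_ge_zero[of x] by linarith
  have "0 \<le> C" using g(2)[of 0] by (simp add: order_trans[OF norm_ge_zero])
  have bd: "norm (g x * \<psi> x) \<le> (C * ?p) * ?w x" for x
  proof -
    have "norm (\<psi> x) * (1 + norm x) ^ (N + 2 * CARD('n)) \<le> ?p"
      using le_schwartz_seminorm[OF \<psi>, of "[]" "N + 2 * CARD('n)" x] by simp
    hence "norm (\<psi> x) * (1 + norm x) ^ N \<le> ?p * ?w x"
      using pos[of x] by (simp add: power_add field_simps)
    moreover have "norm (g x * \<psi> x) \<le> C * (norm (\<psi> x) * (1 + norm x) ^ N)"
      using mult_right_mono[OF g(2)[of x], of "norm (\<psi> x)"] by (simp add: norm_mult mult_ac)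
    ultimately show ?thesis
      using mult_left_mono[of _ _ C] \<open>0 \<le> C\<close> by (fastforce simp: mult.assoc intro: order_trans)
  qed
  have meas: "(\<lambda>x. g x * \<psi> x) \<in> borel_measurable lborel"
    using g(1) smooth_continuous[OF schwartz_smooth[OF \<psi>]]
    by (auto intro!: borel_measurable_continuous_onI continuous_on_mult)
  have w: "integrable lborel (\<lambda>x. (C * ?p) * ?w x)"
    by (intro integrable_mult_right integrable_inverse_growth)
  show int: "integrable lborel (\<lambda>x. g x * \<psi> x)"
    by (rule Bochner_Integration.integrable_bound[OF w meas])
       (use bd in \<open>auto intro!: order_trans[OF _ abs_ge_self]\<close>)
  have "norm (fun_distribution g \<psi>) \<le> (LINT x|lborel. norm (g x * \<psi> x))"
    unfolding fun_distribution_def by (rule integral_norm_bound)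
  also have "\<dots> \<le> (LINT x|lborel. (C * ?p) * ?w x)"
    by (intro integral_mono integrable_norm int w bd)
  finally show "norm (fun_distribution g \<psi>) \<le> C * ((LINT x|lborel. ?w x) * ?p)"
    by (simp add: mult_ac)
qed

lemma growth_tempered:
  fixes g :: "real ^ 'n::finite \<Rightarrow> complex"
  assumes g: "continuous_on UNIV g" "\<And>x. norm (g x) \<le> C * (1 + norm x) ^ N"
  shows "pairs_with_schwartz g" and "tempered_distribution (fun_distribution g)"
proof -
  show "pairs_with_schwartz g"
    unfolding pairs_with_schwartz_def using growth_schwartz_integral[OF g] by blast
  show "tempered_distribution (fun_distribution g)"
    unfolding tempered_distribution_def
  proof (intro conjI ballI allI)
    fix \<phi> \<psi> :: "real ^ 'n \<Rightarrow> complex" and a b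
    assume S: "\<phi> \<in> schwartz" "\<psi> \<in> schwartz"
    have "fun_distribution g (\<lambda>x. a * \<phi> x + b * \<psi> x)
        = (LINT x|lborel. a * (g x * \<phi> x) + b * (g x * \<psi> x))"
      unfolding fun_distribution_def by (simp add: algebra_simps)
    also have "\<dots> = a * fun_distribution g \<phi> + b * fun_distribution g \<psi>"
      unfolding fun_distribution_def
      using S by (simp add: growth_schwartz_integral[OF g])
    finally show "fun_distribution g (\<lambda>x. a * \<phi> x + b * \<psi> x)
        = a * fun_distribution g \<phi> + b * fun_distribution g \<psi>" .
  next
    show "\<exists>d. seminorm_bounded (fun_distribution g) d"
      unfolding seminorm_bounded_def
      using growth_schwartz_integral(2)[OF g] by (metis mult.assoc)
  qed
qed

text \<open>The growth exponent N is the same for all t, so every test function is paired at the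
  cost of one constant M. The rate is needed only for t \<le> 1, the growth bound for all t >
  0.\<close>

lemma seminorm_bigo_growth:
  fixes g :: "real \<Rightarrow> real ^ 'n::finite \<Rightarrow> complex"
  assumes g: "\<And>t. t > 0 \<Longrightarrow> continuous_on UNIV (g t)"
    "\<And>t x. t > 0 \<Longrightarrow> norm (g t x) \<le> C t * (1 + norm x) ^ N"
    and C: "\<And>t. 0 < t \<Longrightarrow> t \<le> 1 \<Longrightarrow> C t \<le> K * t powr r"
  shows "seminorm_bigo g r"
  unfolding seminorm_bigo_def distribution_bigo_def
proof (intro conjI allI impI ballI)
  fix \<psi> :: "real ^ 'n \<Rightarrow> complex" assume \<psi>: "\<psi> \<in> schwartz"
  define M where "M = (LINT x|lborel. inverse ((1 + norm (x :: real ^ 'n)) ^ (2 * CARD('n))))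
      * schwartz_seminorm (N + 2 * CARD('n)) \<psi>"
  have "0 \<le> M"
    unfolding M_def by (intro mult_nonneg_nonneg integral_nonneg schwartz_seminorm_nonneg \<psi>) auto
  have "norm (norm (fun_distribution (g t) \<psi>)) \<le> (K * M) * norm (t powr r)" if "0 < t" "t < 1" for t
  proof -
    have "norm (fun_distribution (g t) \<psi>) \<le> C t * M"
      unfolding M_def using growth_schwartz_integral(2)[OF g(1)[of t] g(2)[of t] \<psi>] that by simp
    also have "\<dots> \<le> (K * t powr r) * M"
      using C[of t] that by (intro mult_right_mono \<open>0 \<le> M\<close>) auto
    finally show ?thesis by (simp add: mult_ac)
  qed
  hence "\<forall>\<^sub>F t in at_right 0. norm (norm (fun_distribution (g t) \<psi>)) \<le> (K * M) * norm (t powr r)"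
    unfolding eventually_at_right[OF zero_less_one] by (intro exI[of _ 1]) auto
  thus "(\<lambda>t. norm (fun_distribution (g t) \<psi>)) \<in> O[at_right 0](\<lambda>t. t powr r)"
    by (rule bigoI)
qed (use growth_tempered[OF g] in blast)+

section \<open>Schwartz functions with prescribed moments\<close>

definition gauss_sin :: "real \<Rightarrow> real" where
  "gauss_sin u = exp (- u\<^sup>2 / 2) * sin (2 * pi * u)"

text \<open>It closes the class below under differentiation, and its integral decides whether
  \<open>gauss_sin_primitive\<close> has nonzero mean.\<close>

definition gauss_cos :: "real \<Rightarrow> real" where
  "gauss_cos u = exp (- u\<^sup>2 / 2) * cos (2 * pi * u)"

text \<open>The primitive that vanishes at +infinity. Since \<open>gauss_sin\<close> is odd, this
  primitive is even and hence vanishes at -infinity too.\<close>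

definition gauss_sin_primitive :: "real \<Rightarrow> real" where
  "gauss_sin_primitive u = - (LINT v|lborel. indicator {u..} v * gauss_sin v)"

text \<open>The exponentials enter because \<open>f(ln x)\<close> has the derivative \<open>g(ln x)\<close> with \<open>g(u) = exp(-u) f'(u)\<close>.\<close>

inductive_set moment_class :: "(real \<Rightarrow> real) set" where
  primitive: "gauss_sin_primitive \<in> moment_class"
| sin: "gauss_sin \<in> moment_class"
| cos: "gauss_cos \<in> moment_class"
| add: "f \<in> moment_class \<Longrightarrow> g \<in> moment_class \<Longrightarrow> (\<lambda>u. f u + g u) \<in> moment_class"
| scale: "f \<in> moment_class \<Longrightarrow> (\<lambda>u. c * f u) \<in> moment_class"
| mult_id: "f \<in> moment_class \<Longrightarrow> (\<lambda>u. u * f u) \<in> moment_class"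
| mult_exp: "f \<in> moment_class \<Longrightarrow> (\<lambda>u. exp (c * u) * f u) \<in> moment_class"

section \<open>Derivatives and decay in the logarithmic variable\<close>

lemma gauss_sin_deriv: "(gauss_sin has_real_derivative - (u * gauss_sin u) + 2 * pi * gauss_cos u) (at u)"
  unfolding gauss_sin_def[abs_def] gauss_cos_def
  by (auto intro!: derivative_eq_intros simp: algebra_simps)

lemma gauss_cos_deriv: "(gauss_cos has_real_derivative - (u * gauss_cos u) + (- 2 * pi) * gauss_sin u) (at u)"
  unfolding gauss_cos_def[abs_def] gauss_sin_def
  by (auto intro!: derivative_eq_intros simp: algebra_simps)

text \<open>Decay faster than every exponential in u becomes decay faster than every power of x =
  exp u, both at infinity and at the origin.\<close>

lemma gauss_decay:
  fixes u K :: real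
  shows "exp (- u\<^sup>2 / 2) \<le> exp (K\<^sup>2 / 2) * exp (- K * \<bar>u\<bar>)"
proof -
  have "0 \<le> (K - \<bar>u\<bar>)\<^sup>2" by (rule zero_le_power2)
  hence "- u\<^sup>2 / 2 \<le> K\<^sup>2 / 2 + - K * \<bar>u\<bar>" by (simp add: power2_diff)
  thus ?thesis unfolding exp_add[symmetric] by simp
qed

lemma gauss_sin_decay: "\<bar>gauss_sin u\<bar> \<le> exp (K\<^sup>2 / 2) * exp (- K * \<bar>u\<bar>)"
proof -
  have "\<bar>gauss_sin u\<bar> \<le> exp (- u\<^sup>2 / 2) * 1"
    unfolding gauss_sin_def abs_mult by (intro mult_mono) auto
  thus ?thesis using gauss_decay[of u K] by linarith
qed

lemma gauss_cos_decay: "\<bar>gauss_cos u\<bar> \<le> exp (K\<^sup>2 / 2) * exp (- K * \<bar>u\<bar>)"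
proof -
  have "\<bar>gauss_cos u\<bar> \<le> exp (- u\<^sup>2 / 2) * 1"
    unfolding gauss_cos_def abs_mult by (intro mult_mono) auto
  thus ?thesis using gauss_decay[of u K] by linarith
qed

lemma exp_abs_le_inverse_square: "exp (- \<bar>u :: real\<bar>) \<le> 2 * inverse (1 + u\<^sup>2)"
proof -
  have "1 + u\<^sup>2 \<le> 2 * exp \<bar>u\<bar>"
    using exp_lower_Taylor_quadratic[of "\<bar>u\<bar>"] by simp
  moreover have "0 < 1 + u\<^sup>2" by (smt (verit) zero_le_power2)
  ultimately show ?thesis by (simp add: exp_minus field_simps)
qed

lemma integrable_exp_abs: "integrable lborel (\<lambda>u :: real. exp (- \<bar>u\<bar>))"
proof (rule Bochner_Integration.integrable_bound)
  show "integrable lborel (\<lambda>u :: real. 2 * inverse (1 + u\<^sup>2))"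
    by (intro integrable_mult_right integrable_inverse_one_plus_square)
qed (use exp_abs_le_inverse_square in \<open>auto intro!: order_trans[OF _ abs_ge_self]\<close>)

lemma continuous_gauss_sin: "continuous_on A gauss_sin"
  unfolding gauss_sin_def[abs_def] by (intro continuous_intros) auto

lemma borel_measurable_gauss_sin[measurable]: "gauss_sin \<in> borel_measurable borel"
  by (intro borel_measurable_continuous_onI continuous_gauss_sin)

lemma integrable_gauss_sin: "integrable lborel gauss_sin"
proof (rule Bochner_Integration.integrable_bound)
  show "integrable lborel (\<lambda>u :: real. exp (1 / 2) * exp (- \<bar>u\<bar>))"
    by (intro integrable_mult_right integrable_exp_abs)
qed (use gauss_sin_decay[of _ 1] in \<open>auto\<close>)

lemma gauss_sin_primitive_deriv: "(gauss_sin_primitive has_real_derivative gauss_sin u) (at u)"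
  and gauss_sin_primitive_even: "gauss_sin_primitive (- u) = gauss_sin_primitive u"
proof -
  have "isCont gauss_sin x" for x
    using continuous_gauss_sin[of UNIV] by (simp add: continuous_on_eq_continuous_at)
  then obtain G where G': "\<And>x. (G has_vector_derivative gauss_sin x) (at x)"
    using einterval_antiderivative[of "- \<infinity>" "\<infinity>" gauss_sin] by auto
  hence G: "(G has_real_derivative gauss_sin x) (at x)" for x
    by (simp add: has_real_derivative_iff_has_vector_derivative)
  have diff: "gauss_sin_primitive b - gauss_sin_primitive a = G b - G a" if "a \<le> b" for a b
  proof -
    have i: "integrable lborel (\<lambda>v. indicator A v * gauss_sin v)" if [measurable]: "A \<in> sets borel" for A
      using integrable_real_mult_indicator[OF _ integrable_gauss_sin, of A]
      by (simp add: mult.commute)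
    \<comment> \<open>The difference of the two half-lines is half-open, whereas the fundamental
      theorem is applied on the closed interval; the point b is a null set.\<close>
    have "AE v in lborel. v \<noteq> b" by (rule AE_lborel_singleton)
    hence "AE v in lborel. indicator {a..} v * gauss_sin v - indicator {b..} v * gauss_sin v
        = indicator {a..b} v *\<^sub>R gauss_sin v"
      by eventually_elim (use that in \<open>auto simp: indicator_def\<close>)
    hence "(LINT v|lborel. indicator {a..} v * gauss_sin v - indicator {b..} v * gauss_sin v)
        = (LINT v|lborel. indicator {a..b} v *\<^sub>R gauss_sin v)"
      by (intro integral_cong_AE) auto
    also have "\<dots> = G b - G a"
      by (rule integral_FTC_atLeastAtMost[OF that])
         (auto intro: has_vector_derivative_at_within G' continuous_gauss_sin)
    finally show ?thesis
      unfolding gauss_sin_primitive_def by (subst (asm) Bochner_Integration.integral_diff) (auto intro: i)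
  qed
  have eq: "gauss_sin_primitive = (\<lambda>u. G u + (gauss_sin_primitive 0 - G 0))"
  proof
    fix u show "gauss_sin_primitive u = G u + (gauss_sin_primitive 0 - G 0)"
      using diff[of 0 u] diff[of u 0] by (cases "0 \<le> u") auto
  qed
  show "(gauss_sin_primitive has_real_derivative gauss_sin u) (at u)"
    by (subst eq) (auto intro!: derivative_eq_intros G)
  \<comment> \<open>Oddness of \<open>gauss_sin\<close> makes this difference constant, and it is 0
    at u = 0.\<close>
  have "((\<lambda>u. G (- u) - G u) has_real_derivative 0) (at x)" for x
    using G[of "- x"] by (auto intro!: derivative_eq_intros DERIV_chain2[of G] G simp: gauss_sin_def)
  hence "G (- u) - G u = G (- 0) - G 0"
    by (rule DERIV_isconst_all[rule_format, rotated])
  thus "gauss_sin_primitive (- u) = gauss_sin_primitive u"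
    by (subst (1 2) eq) simp
qed

text \<open>The integrand decays at rate K + 1: rate K is spent on the bound at u, and the remaining
  1 keeps the integral finite. Negative u follow by evenness.\<close>

lemma gauss_sin_primitive_decay:
  assumes "K \<ge> 0"
  shows "\<exists>C. \<forall>u. \<bar>gauss_sin_primitive u\<bar> \<le> C * exp (- K * \<bar>u\<bar>)"
proof -
  define J where "J = (LINT v|lborel. exp (- \<bar>v :: real\<bar>))"
  define C where "C = exp ((K + 1)\<^sup>2 / 2)"
  have pos: "\<bar>gauss_sin_primitive u\<bar> \<le> (C * J) * exp (- K * \<bar>u\<bar>)" if "u \<ge> 0" for u
  proof -
    have "\<bar>gauss_sin_primitive u\<bar> \<le> (LINT v|lborel. norm (indicator {u..} v * gauss_sin v))"
      using integral_norm_bound[of lborel "\<lambda>v. indicator {u..} v * gauss_sin v"]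
      by (simp add: gauss_sin_primitive_def)
    also have "\<dots> \<le> (LINT v|lborel. (C * exp (- K * \<bar>u\<bar>)) * exp (- \<bar>v\<bar>))"
    proof (rule integral_mono)
      show "integrable lborel (\<lambda>v. norm (indicator {u..} v * gauss_sin v))"
        using integrable_real_mult_indicator[OF _ integrable_gauss_sin, of "{u..}"]
        by (intro integrable_norm) (simp add: mult.commute)
      show "norm (indicator {u..} v * gauss_sin v) \<le> (C * exp (- K * \<bar>u\<bar>)) * exp (- \<bar>v\<bar>)" for v
      proof (cases "u \<le> v")
        case True
        hence "K * \<bar>u\<bar> \<le> K * \<bar>v\<bar>" using assms that by (intro mult_left_mono) auto
        hence "exp (- (K + 1) * \<bar>v\<bar>) \<le> exp (- K * \<bar>u\<bar> + - \<bar>v\<bar>)"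
          by (simp add: algebra_simps)
        hence "C * exp (- (K + 1) * \<bar>v\<bar>) \<le> C * exp (- K * \<bar>u\<bar> + - \<bar>v\<bar>)"
          by (intro mult_left_mono) (auto simp: C_def)
        thus ?thesis
          using gauss_sin_decay[of v "K + 1"] True unfolding C_def[symmetric] exp_add by simp
      qed (simp add: C_def)
      show "integrable lborel (\<lambda>v. (C * exp (- K * \<bar>u\<bar>)) * exp (- \<bar>v\<bar>))"
        by (intro integrable_mult_right integrable_exp_abs)
    qed
    finally show ?thesis by (simp add: J_def mult_ac)
  qed
  have "\<bar>gauss_sin_primitive u\<bar> \<le> (C * J) * exp (- K * \<bar>u\<bar>)" for u
    using pos[of u] pos[of "- u"] by (cases "u \<ge> 0") (auto simp: gauss_sin_primitive_even)
  thus ?thesis by blast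
qed

lemma moment_class_deriv:
  assumes "f \<in> moment_class"
  shows "\<exists>f'\<in>moment_class. \<forall>u. (f has_real_derivative f' u) (at u)"
  using assms
proof induction
  case primitive
  thus ?case using gauss_sin_primitive_deriv moment_class.sin by blast
next
  case sin
  have "(\<lambda>u. (- 1) * (u * gauss_sin u) + 2 * pi * gauss_cos u) \<in> moment_class"
    by (intro moment_class.intros)
  thus ?case using gauss_sin_deriv by (intro bexI) auto
next
  case cos
  have "(\<lambda>u. (- 1) * (u * gauss_cos u) + (- 2 * pi) * gauss_sin u) \<in> moment_class"
    by (intro moment_class.intros)
  thus ?case using gauss_cos_deriv by (intro bexI) auto
next
  case (add f g)
  then obtain f' g' where "f' \<in> moment_class" "g' \<in> moment_class"
    "\<forall>u. (f has_real_derivative f' u) (at u)" "\<forall>u. (g has_real_derivative g' u) (at u)" by blast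
  thus ?case
    by (intro bexI[of _ "\<lambda>u. f' u + g' u"]) (auto intro!: derivative_eq_intros moment_class.add)
next
  case (scale f c)
  then obtain f' where "f' \<in> moment_class" "\<forall>u. (f has_real_derivative f' u) (at u)" by blast
  thus ?case
    by (intro bexI[of _ "\<lambda>u. c * f' u"]) (auto intro!: derivative_eq_intros moment_class.scale)
next
  case (mult_id f)
  then obtain f' where "f' \<in> moment_class" "\<forall>u. (f has_real_derivative f' u) (at u)" by blast
  thus ?case using mult_id
    by (intro bexI[of _ "\<lambda>u. f u + u * f' u"])
       (auto intro!: derivative_eq_intros moment_class.add moment_class.mult_id)
next
  case (mult_exp f c)
  then obtain f' where f': "f' \<in> moment_class" "\<forall>u. (f has_real_derivative f' u) (at u)" by blast
  have "(\<lambda>u. c * (exp (c * u) * f u) + exp (c * u) * f' u) \<in> moment_class"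
    by (intro moment_class.add moment_class.scale moment_class.mult_exp f' mult_exp)
  moreover have "((\<lambda>u. exp (c * u) * f u) has_real_derivative
      c * (exp (c * u) * f u) + exp (c * u) * f' u) (at u)" for u
    using f'(2) by (auto intro!: derivative_eq_intros)
  ultimately show ?case by (intro bexI[of _ "\<lambda>u. c * (exp (c * u) * f u) + exp (c * u) * f' u"]) auto
qed

text \<open>The rate K is arbitrary in the induction because a factor u or exp(c u) is paid for by
  applying the hypothesis with the larger rate K + 1 or K + |c|.\<close>

lemma moment_class_decay:
  assumes "f \<in> moment_class" "K \<ge> 0"
  shows "\<exists>C. \<forall>u. \<bar>f u\<bar> \<le> C * exp (- K * \<bar>u\<bar>)"
  using assms
proof (induction arbitrary: K)
  case primitive thus ?case using gauss_sin_primitive_decay by blast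
next
  case sin thus ?case using gauss_sin_decay by blast
next
  case cos thus ?case using gauss_cos_decay by blast
next
  case (add f g)
  then obtain C D where "\<And>u. \<bar>f u\<bar> \<le> C * exp (- K * \<bar>u\<bar>)" "\<And>u. \<bar>g u\<bar> \<le> D * exp (- K * \<bar>u\<bar>)" by metis
  hence "\<bar>f u + g u\<bar> \<le> (C + D) * exp (- K * \<bar>u\<bar>)" for u
    unfolding distrib_right by (intro order_trans[OF abs_triangle_ineq] add_mono)
  thus ?case by blast
next
  case (scale f c)
  then obtain C where "\<And>u. \<bar>f u\<bar> \<le> C * exp (- K * \<bar>u\<bar>)" by metis
  hence "\<bar>c * f u\<bar> \<le> (\<bar>c\<bar> * C) * exp (- K * \<bar>u\<bar>)" for u
    by (simp add: abs_mult mult.assoc mult_left_mono)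
  thus ?case by blast
next
  case (mult_id f)
  obtain C where C: "\<And>u. \<bar>f u\<bar> \<le> C * exp (- (K + 1) * \<bar>u\<bar>)"
    using mult_id.IH[of "K + 1"] mult_id.prems by auto
  have "\<bar>u * f u\<bar> \<le> C * exp (- K * \<bar>u\<bar>)" for u
  proof -
    have "\<bar>u * f u\<bar> \<le> exp \<bar>u\<bar> * (C * exp (- (K + 1) * \<bar>u\<bar>))"
      unfolding abs_mult by (intro mult_mono C order_less_imp_le[OF exp_gt_self]) auto
    also have "\<dots> = C * exp (- K * \<bar>u\<bar>)"
      by (simp add: algebra_simps flip: exp_add)
    finally show ?thesis .
  qed
  thus ?case by blast
next
  case (mult_exp f c)
  obtain C where C: "\<And>u. \<bar>f u\<bar> \<le> C * exp (- (K + \<bar>c\<bar>) * \<bar>u\<bar>)"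
    using mult_exp.IH[of "K + \<bar>c\<bar>"] mult_exp.prems by auto
  have "\<bar>exp (c * u) * f u\<bar> \<le> C * exp (- K * \<bar>u\<bar>)" for u
  proof -
    have "c * u \<le> \<bar>c\<bar> * \<bar>u\<bar>" by (metis abs_ge_self abs_mult)
    hence "\<bar>exp (c * u) * f u\<bar> \<le> exp (\<bar>c\<bar> * \<bar>u\<bar>) * (C * exp (- (K + \<bar>c\<bar>) * \<bar>u\<bar>))"
      unfolding abs_mult by (intro mult_mono C) auto
    also have "\<dots> = C * exp (- K * \<bar>u\<bar>)"
      by (simp add: algebra_simps flip: exp_add)
    finally show ?thesis .
  qed
  thus ?case by blast
qed

section \<open>Integrals of functions in the class\<close>

lemma moment_class_isCont: "f \<in> moment_class \<Longrightarrow> isCont f u"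
  using moment_class_deriv DERIV_isCont by blast

lemma moment_class_integrable:
  assumes "f \<in> moment_class"
  shows "integrable lborel f"
proof -
  obtain C where C: "\<And>u. \<bar>f u\<bar> \<le> C * exp (- 1 * \<bar>u\<bar>)"
    using moment_class_decay[OF assms, of 1] by auto
  have "f \<in> borel_measurable lborel"
    using moment_class_isCont[OF assms]
    by (auto intro!: borel_measurable_continuous_onI continuous_at_imp_continuous_on)
  moreover have "integrable lborel (\<lambda>u :: real. C * exp (- \<bar>u\<bar>))"
    by (intro integrable_mult_right integrable_exp_abs)
  ultimately show ?thesis
  proof (intro Bochner_Integration.integrable_bound[of lborel "\<lambda>u. C * exp (- \<bar>u\<bar>)" f] AE_I2)
    show "norm (f u) \<le> norm (C * exp (- \<bar>u\<bar>))" for u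
      using order_trans[OF C abs_ge_self, of u] by simp
  qed
qed

lemma moment_class_integral_deriv:
  assumes "f \<in> moment_class" "f' \<in> moment_class" "\<And>u. (f has_real_derivative f' u) (at u)"
  shows "(LINT u|lborel. f' u) = 0"
proof -
  obtain C where C: "\<And>u. \<bar>f u\<bar> \<le> C * exp (- 1 * \<bar>u\<bar>)"
    using moment_class_decay[OF assms(1), of 1] by auto
  \<comment> \<open>A general filter along which |u| tends to infinity treats both ends of the line
    at once.\<close>
  have lim: "(f \<longlongrightarrow> 0) F" if "filterlim abs at_top F" for F
  proof (rule Lim_null_comparison)
    show "\<forall>\<^sub>F u in F. norm (f u) \<le> C * exp (- \<bar>u\<bar>)" using C by simp
    have "((\<lambda>u. exp (- \<bar>u\<bar>)) \<longlongrightarrow> 0) F"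
      by (rule filterlim_compose[OF exp_at_bot]) (use that in \<open>simp add: filterlim_uminus_at_bot\<close>)
    thus "((\<lambda>u. C * exp (- \<bar>u\<bar>)) \<longlongrightarrow> 0) F" by (rule tendsto_mult_right_zero)
  qed
  have "(LBINT u=-\<infinity>..\<infinity>. f' u) = 0 - 0"
  proof (rule interval_integral_FTC_integrable[where F = f])
    show "set_integrable lborel (einterval (- \<infinity>) \<infinity>) f'"
      using moment_class_integrable[OF assms(2)] by (simp add: set_integrable_def einterval_def)
    show "((f \<circ> real_of_ereal) \<longlongrightarrow> 0) (at_right (- \<infinity>))" "((f \<circ> real_of_ereal) \<longlongrightarrow> 0) (at_left \<infinity>)"
      unfolding ereal_tendsto_simps
      by (auto intro!: lim filterlim_at_top_mono[OF filterlim_ident] filterlim_at_top_mono[OF filterlim_uminus_at_top_at_bot] always_eventually)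
  qed (use assms moment_class_isCont in \<open>auto simp: has_real_derivative_iff_has_vector_derivative\<close>)
  thus ?thesis
    by (simp add: interval_lebesgue_integral_def set_lebesgue_integral_def einterval_def)
qed

text \<open>The translation u -> u + j completes the square: the exponential is absorbed by the
  Gaussian up to the constant exp(j^2 / 2), and the sine is unchanged as j is an integer. What is
  left is the integral of an odd function.\<close>

lemma integral_exp_gauss_sin:
  "(LINT u|lborel. exp (of_int j * u) * gauss_sin u) = 0"
proof -
  let ?I = "LINT u|lborel. gauss_sin u"
  have "?I = \<bar>- 1 :: real\<bar> *\<^sub>R (LINT u|lborel. gauss_sin (0 + - 1 * u))"
    by (rule lborel_integral_real_affine) simp
  also have "(\<lambda>u. gauss_sin (0 + - 1 * u)) = (\<lambda>u. - gauss_sin u)"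
    by (auto simp: gauss_sin_def)
  finally have I: "?I = 0" by simp
  let ?f = "\<lambda>u. exp (of_int j * u) * gauss_sin u"
  have "(LINT u|lborel. ?f u) = \<bar>1 :: real\<bar> *\<^sub>R (LINT u|lborel. ?f (of_int j + 1 * u))"
    by (rule lborel_integral_real_affine) simp
  also have "(\<lambda>u. ?f (of_int j + 1 * u)) = (\<lambda>u. exp ((of_int j)\<^sup>2 / 2) * gauss_sin u)"
  proof
    fix u :: real
    have "sin (2 * pi * (of_int j + u)) = sin (2 * pi * u)"
      using sin_add[of "2 * pi * of_int j" "2 * pi * u"]
      by (simp add: distrib_left sin_int_2pin cos_int_2pin)
    moreover have "of_int j * (of_int j + u) + - (of_int j + u)\<^sup>2 / 2 = (of_int j)\<^sup>2 / 2 + - u\<^sup>2 / 2"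
      by (simp add: power2_eq_square field_simps)
    hence "exp (of_int j * (of_int j + u)) * exp (- (of_int j + u)\<^sup>2 / 2) = exp ((of_int j)\<^sup>2 / 2) * exp (- u\<^sup>2 / 2)"
      by (simp only: exp_add[symmetric])
    ultimately show "?f (of_int j + 1 * u) = exp ((of_int j)\<^sup>2 / 2) * gauss_sin u"
      by (simp add: gauss_sin_def mult.assoc[symmetric])
  qed
  finally show ?thesis using I by simp
qed

lemma integral_exp_primitive:
  assumes "j \<noteq> 0"
  shows "(LINT u|lborel. exp (of_int j * u) * gauss_sin_primitive u) = 0"
proof -
  let ?F = gauss_sin_primitive
  have mem: "(\<lambda>u. exp (of_int j * u) * ?F u) \<in> moment_class" "(\<lambda>u. exp (of_int j * u) * gauss_sin u) \<in> moment_class"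
    by (intro moment_class.intros)+
  have "(LINT u|lborel. of_int j * (exp (of_int j * u) * ?F u) + exp (of_int j * u) * gauss_sin u) = 0"
  proof (rule moment_class_integral_deriv[OF mem(1)])
    show "(\<lambda>u. of_int j * (exp (of_int j * u) * ?F u) + exp (of_int j * u) * gauss_sin u) \<in> moment_class"
      by (intro moment_class.intros)
    show "((\<lambda>u. exp (of_int j * u) * ?F u) has_real_derivative
        of_int j * (exp (of_int j * u) * ?F u) + exp (of_int j * u) * gauss_sin u) (at u)" for u
      by (auto intro!: derivative_eq_intros gauss_sin_primitive_deriv)
  qed
  hence "of_int j * (LINT u|lborel. exp (of_int j * u) * ?F u) = 0"
    using moment_class_integrable[OF mem(1)] moment_class_integrable[OF mem(2)]
    by (simp add: integral_exp_gauss_sin)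
  thus ?thesis using assms by simp
qed

text \<open>Up to the factor sqrt(2 pi) this is the characteristic function of the standard normal
  law at 2 pi, that is exp(-2 pi^2).\<close>

lemma integral_gauss_cos_pos: "(LINT u|lborel. gauss_cos u) > 0"
proof -
  let ?c = "1 / sqrt (2 * pi)"
  interpret real_distribution std_normal_distribution by (rule real_dist_normal_dist)
  have int: "integrable std_normal_distribution (\<lambda>u. iexp ((2 * pi) * u))"
    by (rule integrable_const_bound[where B = 1]) auto
  have "exp (- ((2 * pi)\<^sup>2) / 2) = Re (char std_normal_distribution (2 * pi))"
    by (simp only: char_std_normal_distribution Re_complex_of_real)
  also have "\<dots> = (LINT u|std_normal_distribution. Re (iexp ((2 * pi) * u)))"
    unfolding char_def by (rule integral_Re[OF int, symmetric])
  also have "\<dots> = (LINT u|std_normal_distribution. cos (2 * pi * u))"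
    by (simp add: Re_exp)
  also have "\<dots> = (LINT u|lborel. std_normal_density u *\<^sub>R cos (2 * pi * u))"
    by (rule integral_density) auto
  also have "\<dots> = (LINT u|lborel. ?c * gauss_cos u)"
    by (simp add: std_normal_density_def gauss_cos_def)
  finally have "0 < ?c * (LINT u|lborel. gauss_cos u)"
    by (metis exp_gt_zero integral_mult_right_zero)
  thus ?thesis by (auto simp: zero_less_divide_iff)
qed

text \<open>Integrating the derivatives of u F(u) and of \<open>gauss_sin\<close> over the line
  gives the value -2 pi times the integral of \<open>gauss_cos\<close>, a negative number.\<close>

lemma integral_primitive_nonzero: "(LINT u|lborel. gauss_sin_primitive u) \<noteq> 0"
proof -
  let ?F = gauss_sin_primitive
  have mem: "?F \<in> moment_class" "(\<lambda>u. u * gauss_sin u) \<in> moment_class" "gauss_cos \<in> moment_class"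
    by (intro moment_class.intros)+
  note int = mem[THEN moment_class_integrable]
  have "(LINT u|lborel. ?F u + u * gauss_sin u) = 0"
    by (rule moment_class_integral_deriv[of "\<lambda>u. u * ?F u"])
       (auto intro!: moment_class.intros derivative_eq_intros gauss_sin_primitive_deriv)
  moreover have "(LINT u|lborel. (- 1) * (u * gauss_sin u) + (2 * pi) * gauss_cos u) = 0"
  proof (rule moment_class_integral_deriv)
    show "(\<lambda>u. (- 1) * (u * gauss_sin u) + (2 * pi) * gauss_cos u) \<in> moment_class" "gauss_sin \<in> moment_class"
      by (intro moment_class.intros)+
  qed (use gauss_sin_deriv in simp)
  ultimately have "(LINT u|lborel. ?F u) + (LINT u|lborel. u * gauss_sin u) = 0"
    "(2 * pi) * (LINT u|lborel. gauss_cos u) = (LINT u|lborel. u * gauss_sin u)"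
    using int by simp_all
  moreover have "(2 * pi) * (LINT u|lborel. gauss_cos u) > 0"
    using integral_gauss_cos_pos by simp
  ultimately show ?thesis by linarith
qed

text \<open>Extension by 0 keeps all derivatives for f in \<open>moment_class\<close>: rapid decay
  of f at -infinity is flatness at the origin.\<close>

definition exp_lift :: "(real \<Rightarrow> real) \<Rightarrow> real \<Rightarrow> real" where
  "exp_lift f x = (if x > 0 then f (ln x) else 0)"

lemma exp_lift_decay:
  assumes "f \<in> moment_class"
  shows "\<exists>B. \<forall>x. \<bar>exp_lift f x\<bar> * (1 + \<bar>x\<bar>) ^ N \<le> B"
proof -
  obtain C where C: "\<And>u. \<bar>f u\<bar> \<le> C * exp (- real N * \<bar>u\<bar>)"
    using moment_class_decay[OF assms, of "real N"] by auto
  have "C \<ge> 0" using C[of 0] by simp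
  have "\<bar>exp_lift f x\<bar> * (1 + \<bar>x\<bar>) ^ N \<le> C * 2 ^ N" for x
  proof (cases "x > 0")
    case True
    \<comment> \<open>Both 1 and x are at most exp |ln x|, so the weight is at most (2 exp |ln
      x|)^N, and decay of f at rate N compensates it exactly.\<close>
    have "exp (ln x) \<le> exp \<bar>ln x\<bar>" by simp
    hence "x \<le> exp \<bar>ln x\<bar>" using True by simp
    hence "(1 + \<bar>x\<bar>) ^ N \<le> (2 * exp \<bar>ln x\<bar>) ^ N"
      using True one_le_exp_iff[of "\<bar>ln x\<bar>"] by (intro power_mono) linarith+
    also have "\<dots> = 2 ^ N * exp (real N * \<bar>ln x\<bar>)"
      by (simp add: power_mult_distrib exp_of_nat_mult)
    finally have "\<bar>exp_lift f x\<bar> * (1 + \<bar>x\<bar>) ^ N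
        \<le> (C * exp (- real N * \<bar>ln x\<bar>)) * (2 ^ N * exp (real N * \<bar>ln x\<bar>))"
      using True C[of "ln x"] \<open>C \<ge> 0\<close> by (intro mult_mono) (auto simp: exp_lift_def)
    also have "\<dots> = C * 2 ^ N"
      by (simp add: exp_minus)
    finally show ?thesis .
  qed (use \<open>C \<ge> 0\<close> in \<open>simp add: exp_lift_def\<close>)
  thus ?thesis by blast
qed

lemma exp_lift_deriv:
  assumes f: "f \<in> moment_class" "\<And>u. (f has_real_derivative f' u) (at u)"
  shows "(exp_lift f has_real_derivative exp_lift (\<lambda>u. exp (- 1 * u) * f' u) x) (at x)"
proof -
  consider "x > 0" | "x < 0" | "x = 0" by linarith
  thus ?thesis
  proof cases
    case 1
    have "((\<lambda>x. f (ln x)) has_real_derivative f' (ln x) * inverse x) (at x)"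
      using 1 by (intro DERIV_chain2[OF f(2)]) (auto intro!: derivative_eq_intros simp: field_simps)
    moreover have "\<forall>\<^sub>F y in nhds x. exp_lift f y = f (ln y)"
      using eventually_nhds_in_open[of "{0<..}" x] 1 by (auto elim!: eventually_mono simp: exp_lift_def)
    ultimately show ?thesis
      using 1 by (subst DERIV_cong_ev[OF refl _ refl]) (auto simp: exp_lift_def exp_minus mult.commute)
  next
    case 2
    have "\<forall>\<^sub>F y in nhds x. exp_lift f y = 0"
      using eventually_nhds_in_open[of "{..<0}" x] 2 by (auto elim!: eventually_mono simp: exp_lift_def)
    thus ?thesis
      using 2 by (subst DERIV_cong_ev[OF refl _ refl]) (auto simp: exp_lift_def)
  next
    case 3
    \<comment> \<open>Rate 2 in u gives a bound C h^2 in h = exp u, just what is needed for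
      derivative 0 at the origin.\<close>
    obtain C where C: "\<And>u. \<bar>f u\<bar> \<le> C * exp (- 2 * \<bar>u\<bar>)"
      using moment_class_decay[OF f(1), of 2] by auto
    have "C \<ge> 0" using C[of 0] by simp
    have bd: "\<bar>exp_lift f h\<bar> \<le> C * \<bar>h\<bar> ^ 2" for h
    proof (cases "h > 0")
      case True
      have "\<bar>f (ln h)\<bar> \<le> C * exp (2 * ln h)"
        by (rule order_trans[OF C]) (use \<open>C \<ge> 0\<close> in \<open>auto intro!: mult_left_mono\<close>)
      also have "exp (2 * ln h) = h ^ 2"
        using True exp_of_nat_mult[of 2 "ln h"] by simp
      finally show ?thesis using True by (simp add: exp_lift_def)
    qed (use \<open>C \<ge> 0\<close> in \<open>simp add: exp_lift_def\<close>)
    have "(exp_lift f has_derivative (\<lambda>h. 0)) (at 0)"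
      by (rule has_derivative_quadraticI[where K = C]) (use bd in \<open>auto simp: exp_lift_def bounded_linear_zero\<close>)
    moreover have "(*) (0 :: real) = (\<lambda>h. 0)" by auto
    ultimately show ?thesis using 3 by (simp add: has_field_derivative_def exp_lift_def)
  qed
qed

text \<open>The substitution x = exp u; the Jacobian raises the exponent from k to k + 1.\<close>

lemma exp_lift_moment:
  assumes "f \<in> moment_class"
  shows "integrable lborel (\<lambda>x. x ^ k * exp_lift f x)"
    and "(LINT x|lborel. x ^ k * exp_lift f x) = (LINT u|lborel. exp (real (k + 1) * u) * f u)"
proof -
  let ?g = "\<lambda>x. x ^ k * exp_lift f x" and ?h = "\<lambda>u. exp (real (k + 1) * u) * f u"
  have h: "integrable lborel ?h"
    by (intro moment_class_integrable moment_class.mult_exp assms)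
  have eq: "(\<lambda>u. \<bar>exp u\<bar> * ?g (exp u)) = ?h"
    by (rule ext) (simp add: exp_lift_def exp_of_nat_mult[symmetric] exp_add[symmetric] algebra_simps)
  have "?h absolutely_integrable_on UNIV" and hI: "integral UNIV ?h = (LINT u|lborel. ?h u)"
    using h integral_lborel[OF h] by (auto simp: integrable_on_lborel absolutely_integrable_on_def set_integrable_def integrable_completion)
  hence "(\<lambda>u. \<bar>exp u\<bar> * ?g (exp u)) absolutely_integrable_on UNIV \<and>
      integral UNIV (\<lambda>u. \<bar>exp u\<bar> * ?g (exp u)) = (LINT u|lborel. ?h u)"
    unfolding eq by blast
  hence "?g absolutely_integrable_on (range exp) \<and> integral (range exp) ?g = (LINT u|lborel. ?h u)"
    by (subst (asm) has_absolute_integral_change_of_variables_1')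
       (auto intro!: derivative_eq_intros simp: inj_def)
  moreover have "range exp = {0 :: real<..}"
    by (auto simp: image_iff) (metis exp_ln)
  ultimately have g: "?g absolutely_integrable_on {0<..}" "integral {0<..} ?g = (LINT u|lborel. ?h u)"
    by auto
  have ind: "(\<lambda>x. indicator {0<..} x *\<^sub>R ?g x) = ?g"
    by (auto simp: exp_lift_def indicator_def)
  \<comment> \<open>The change of variables yields integrability for the completed measure; Borel
    measurability brings it back to \<open>lborel\<close>.\<close>
  have meas: "?g \<in> borel_measurable borel"
  proof -
    obtain f' where f': "\<And>u. (f has_real_derivative f' u) (at u)"
      using moment_class_deriv[OF assms] by blast
    have "continuous_on UNIV (exp_lift f)"
      using DERIV_isCont[OF exp_lift_deriv[OF assms f']] by (simp add: continuous_at_imp_continuous_on)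
    thus ?thesis by (intro borel_measurable_continuous_onI continuous_intros)
  qed
  show gi: "integrable lborel ?g"
    using g(1) meas unfolding set_integrable_def ind by (simp add: integrable_completion)
  have "(LINT x|lborel. ?g x) = integral UNIV ?g"
    using integral_lborel[OF gi] by simp
  also have "\<dots> = integral {0<..} ?g"
  proof -
    have "?g = (\<lambda>x. if x \<in> {0<..} then ?g x else 0)" by (auto simp: exp_lift_def)
    thus ?thesis by (metis integral_restrict_UNIV)
  qed
  finally show "(LINT x|lborel. ?g x) = (LINT u|lborel. ?h u)" using g(2) by simp
qed

definition exp_lift_tensor :: "('n::finite \<Rightarrow> real \<Rightarrow> real) \<Rightarrow> real ^ 'n \<Rightarrow> complex" where
  "exp_lift_tensor f x = of_real (\<Prod>i\<in>UNIV. exp_lift (f i) (x $ i))"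

text \<open>Splits the weight over the coordinates, so that decay of a tensor product reduces to
  decay of its factors.\<close>

lemma one_plus_norm_le_prod: "1 + norm (x :: real ^ 'n::finite) \<le> (\<Prod>i\<in>UNIV. 1 + \<bar>x $ i\<bar>)"
proof -
  have "1 + (\<Sum>i\<in>A. \<bar>x $ i\<bar>) \<le> (\<Prod>i\<in>A. 1 + \<bar>x $ i\<bar>)" if "finite A" for A
    using that
  proof induction
    case (insert i A)
    have "1 + (\<bar>x $ i\<bar> + (\<Sum>i\<in>A. \<bar>x $ i\<bar>)) \<le> (1 + \<bar>x $ i\<bar>) * (1 + (\<Sum>i\<in>A. \<bar>x $ i\<bar>))"
      by (simp add: algebra_simps sum_nonneg)
    also have "\<dots> \<le> (1 + \<bar>x $ i\<bar>) * (\<Prod>i\<in>A. 1 + \<bar>x $ i\<bar>)"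
      using insert.IH by (intro mult_left_mono) auto
    finally show ?case using insert by simp
  qed simp
  from this[of UNIV] show ?thesis using norm_le_l1_cart[of x] by simp
qed

text \<open>Differentiation in direction j replaces only the j-th factor, by the lift of exp(-u)
  f_j'(u), so tensor products of lifts form a class closed under partial derivatives.\<close>

lemma exp_lift_tensor_partial:
  fixes f :: "'n::finite \<Rightarrow> real \<Rightarrow> real"
  assumes f: "\<And>i. f i \<in> moment_class"
  shows "exp_lift_tensor f differentiable_on UNIV"
    and "\<exists>h. (\<forall>i. h i \<in> moment_class) \<and> partial j (exp_lift_tensor f) = exp_lift_tensor h"
proof -
  obtain f' where f': "\<And>i. f' i \<in> moment_class" "\<And>i u. (f i has_real_derivative f' i u) (at u)"
    using moment_class_deriv[OF f] by metis
  define e where "e i = (\<lambda>u. exp (- 1 * u) * f' i u)" for i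
  have e: "e i \<in> moment_class" for i unfolding e_def by (intro moment_class.mult_exp f')
  have comp: "((\<lambda>x. exp_lift (f i) (x $ i)) has_derivative (\<lambda>h. h $ i * exp_lift (e i) (x $ i))) (at x)" for x :: "real ^ 'n" and i
    using has_derivative_compose[OF bounded_linear_imp_has_derivative[OF bounded_linear_vec_nth]
      exp_lift_deriv[OF f[of i] f'(2)[of i], unfolded has_field_derivative_def]]
    by (simp add: e_def mult.commute)
  have der: "(exp_lift_tensor f has_derivative (\<lambda>h. of_real (\<Sum>i\<in>UNIV. (h $ i * exp_lift (e i) (x $ i))
      * (\<Prod>k\<in>UNIV - {i}. exp_lift (f k) (x $ k))))) (at x)" for x
    unfolding exp_lift_tensor_def[abs_def]
    by (intro has_derivative_of_real has_derivative_prod comp)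
  show "exp_lift_tensor f differentiable_on UNIV"
    using der by (auto simp: differentiable_on_def differentiable_def)
  have "partial j (exp_lift_tensor f) x = exp_lift_tensor (f(j := e j)) x" for x
  proof -
    have "exp_lift_tensor (f(j := e j)) x
        = of_real (exp_lift (e j) (x $ j) * (\<Prod>k\<in>UNIV - {j}. exp_lift (f k) (x $ k)))"
      unfolding exp_lift_tensor_def by (subst prod.remove[of UNIV j]) auto
    thus ?thesis
      unfolding partial_eqI[OF der]
      by (simp add: axis_def if_distrib[of "\<lambda>x. x * _"] cong: if_cong)
  qed
  thus "\<exists>h. (\<forall>i. h i \<in> moment_class) \<and> partial j (exp_lift_tensor f) = exp_lift_tensor h"
    using f e by (intro exI[of _ "f(j := e j)"]) auto
qed

lemma exp_lift_tensor_schwartz: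
  fixes f :: "'n::finite \<Rightarrow> real \<Rightarrow> real"
  assumes "\<And>i. f i \<in> moment_class"
  shows "exp_lift_tensor f \<in> schwartz"
proof (rule schwartz_coinduct[of _ "{exp_lift_tensor f | f. \<forall>i. f i \<in> moment_class}"])
  show "g differentiable_on UNIV" if "g \<in> {exp_lift_tensor f | f. \<forall>i. f i \<in> moment_class}"
    for g :: "real ^ 'n \<Rightarrow> complex"
    using that exp_lift_tensor_partial(1) by auto
  show "partial i g \<in> {exp_lift_tensor f | f. \<forall>i. f i \<in> moment_class}"
    if "g \<in> {exp_lift_tensor f | f. \<forall>i. f i \<in> moment_class}" for i and g :: "real ^ 'n \<Rightarrow> complex"
    using that exp_lift_tensor_partial(2) by fastforce
  show "\<exists>B. \<forall>x. norm (g x) * (1 + norm x) ^ N \<le> B"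
    if g: "g \<in> {exp_lift_tensor f | f. \<forall>i. f i \<in> moment_class}" for N and g :: "real ^ 'n \<Rightarrow> complex"
  proof -
    from g obtain f where f: "g = exp_lift_tensor f" "\<And>i. f i \<in> moment_class" by auto
    have "\<forall>i. \<exists>B. \<forall>x. \<bar>exp_lift (f i) x\<bar> * (1 + \<bar>x\<bar>) ^ N \<le> B"
      using exp_lift_decay[OF f(2)] by blast
    then obtain B where B: "\<And>i x. \<bar>exp_lift (f i) x\<bar> * (1 + \<bar>x\<bar>) ^ N \<le> B i"
      by metis
    have "norm (g x) * (1 + norm x) ^ N \<le> (\<Prod>i\<in>UNIV. B i)" for x
    proof -
      have "norm (g x) * (1 + norm x) ^ N
          \<le> (\<Prod>i\<in>UNIV. \<bar>exp_lift (f i) (x $ i)\<bar>) * (\<Prod>i\<in>UNIV. 1 + \<bar>x $ i\<bar>) ^ N"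
        unfolding f exp_lift_tensor_def
        by (intro mult_mono power_mono one_plus_norm_le_prod) (auto simp: abs_prod prod_nonneg simp flip: prod_norm)
      also have "\<dots> = (\<Prod>i\<in>UNIV. \<bar>exp_lift (f i) (x $ i)\<bar> * (1 + \<bar>x $ i\<bar>) ^ N)"
        by (simp add: prod.distrib prod_power_distrib)
      also have "\<dots> \<le> (\<Prod>i\<in>UNIV. B i)"
        by (intro prod_mono) (auto simp: B)
      finally show ?thesis .
    qed
    thus ?thesis by blast
  qed
qed (use assms in auto)

lemma schwartz_dual_monomials:
  fixes \<alpha> :: "'n::finite \<Rightarrow> nat"
  obtains \<psi> :: "real ^ 'n \<Rightarrow> complex" where "\<psi> \<in> schwartz"
    "\<And>\<beta>. integrable lborel (\<lambda>x. of_real (mi_power x \<beta>) * \<psi> x)"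
    "\<And>\<beta>. (LINT x|lborel. of_real (mi_power x \<beta>) * \<psi> x) = (if \<beta> = \<alpha> then 1 else 0)"
proof -
  define c where "c = (LINT u|lborel. gauss_sin_primitive u)"
  \<comment> \<open>In exp(-(\<open>\<alpha> i\<close> + 1) u) the 1 cancels the Jacobian, and
    \<open>\<alpha> i\<close> shifts the only surviving moment from order 0 to order
    \<open>\<alpha> i\<close>; division by c normalises it.\<close>
  define f where "f i = (\<lambda>u. (1 / c) * (exp (- real (\<alpha> i + 1) * u) * gauss_sin_primitive u))" for i
  have f: "f i \<in> moment_class" for i unfolding f_def by (intro moment_class.intros)
  have mom: "(LINT x|lborel. x ^ k * exp_lift (f i) x) = (if k = \<alpha> i then 1 else 0)" for k i
  proof -
    have "(\<lambda>u. exp (real (k + 1) * u) * f i u)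
        = (\<lambda>u. (1 / c) * (exp (of_int (int k - int (\<alpha> i)) * u) * gauss_sin_primitive u))"
    proof
      fix u
      have "exp (of_int (int k - int (\<alpha> i)) * u) = exp (real (k + 1) * u) * exp (- real (\<alpha> i + 1) * u)"
        unfolding exp_add[symmetric] by (simp add: algebra_simps)
      thus "exp (real (k + 1) * u) * f i u
          = (1 / c) * (exp (of_int (int k - int (\<alpha> i)) * u) * gauss_sin_primitive u)"
        by (simp add: f_def)
    qed
    hence "(LINT x|lborel. x ^ k * exp_lift (f i) x)
        = (1 / c) * (LINT u|lborel. exp (of_int (int k - int (\<alpha> i)) * u) * gauss_sin_primitive u)"
      by (simp only: exp_lift_moment(2)[OF f] integral_mult_right_zero)
    thus ?thesis
      using integral_exp_primitive[of "int k - int (\<alpha> i)"] integral_primitive_nonzero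
      by (auto simp: c_def)
  qed
  have eq: "of_real (mi_power x \<beta>) * exp_lift_tensor f x
      = of_real (\<Prod>i\<in>UNIV. (x $ i) ^ \<beta> i * exp_lift (f i) (x $ i))" for \<beta> x
    by (simp add: mi_power_def exp_lift_tensor_def prod.distrib)
  show ?thesis
  proof (rule that)
    show "exp_lift_tensor f \<in> schwartz" by (rule exp_lift_tensor_schwartz[OF f])
    fix \<beta>
    show "integrable lborel (\<lambda>x. of_real (mi_power x \<beta>) * exp_lift_tensor f x)"
      unfolding eq by (intro integrable_of_real lborel_integral_prod_vec exp_lift_moment f)
    have "(LINT x|lborel. of_real (mi_power x \<beta>) * exp_lift_tensor f x)
        = of_real (\<Prod>i\<in>UNIV. if \<beta> i = \<alpha> i then 1 else 0)"
      unfolding eq integral_complex_of_real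
      by (subst lborel_integral_prod_vec(2)) (auto intro: exp_lift_moment f simp: mom)
    thus "(LINT x|lborel. of_real (mi_power x \<beta>) * exp_lift_tensor f x) = (if \<beta> = \<alpha> then 1 else 0)"
      by (auto simp: fun_eq_iff)
  qed
qed

section \<open>Asymptotics of the Taylor polynomials\<close>

lemma abs_mi_power_le: "\<bar>mi_power x \<alpha>\<bar> \<le> (1 + norm x) ^ mi_size \<alpha>"
proof -
  have "\<bar>mi_power x \<alpha>\<bar> = (\<Prod>i\<in>UNIV. \<bar>x $ i\<bar> ^ \<alpha> i)"
    by (simp add: mi_power_def abs_prod power_abs)
  also have "\<dots> \<le> (\<Prod>i\<in>UNIV. (1 + norm x) ^ \<alpha> i)"
    by (intro prod_mono conjI power_mono)
       (auto intro: order_trans[OF component_le_norm_cart])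
  also have "\<dots> = (1 + norm x) ^ mi_size \<alpha>"
    by (simp add: power_sum mi_size_def)
  finally show ?thesis .
qed

lemma mi_fact_ge_1: "mi_fact \<alpha> \<ge> 1"
  unfolding mi_fact_def by (intro prod_ge_1) auto

lemma norm_taylor_term_le:
  assumes "norm (mi_partial \<alpha> g 0) \<le> B"
  shows "norm (taylor_term g \<alpha> x) \<le> B * (1 + norm x) ^ mi_size \<alpha>"
proof -
  have "norm (taylor_term g \<alpha> x) = norm (mi_partial \<alpha> g 0) * (\<bar>mi_power x \<alpha>\<bar> / mi_fact \<alpha>)"
    using mi_fact_ge_1[of \<alpha>] by (simp add: taylor_term_def norm_mult norm_divide)
  also have "\<bar>mi_power x \<alpha>\<bar> / mi_fact \<alpha> \<le> \<bar>mi_power x \<alpha>\<bar> / 1"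
    using mi_fact_ge_1[of \<alpha>] by (intro divide_left_mono) auto
  hence "norm (mi_partial \<alpha> g 0) * (\<bar>mi_power x \<alpha>\<bar> / mi_fact \<alpha>) \<le> B * (1 + norm x) ^ mi_size \<alpha>"
    using abs_mi_power_le[of x \<alpha>] order_trans[OF norm_ge_zero assms] mi_fact_ge_1[of \<alpha>]
    by (intro mult_mono assms) auto
  finally show ?thesis .
qed

text \<open>Used for Q of degree m(t) and for a Taylor polynomial of fixed degree alike. The other
  monomials are annihilated exactly, so the identity involves no constant that could grow with
  m.\<close>

lemma fun_distribution_polynomial_part:
  fixes \<psi> :: "real ^ 'n::finite \<Rightarrow> complex"
  assumes \<psi>: "\<And>\<beta>. integrable lborel (\<lambda>x. of_real (mi_power x \<beta>) * \<psi> x)"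
    "\<And>\<beta>. (LINT x|lborel. of_real (mi_power x \<beta>) * \<psi> x) = (if \<beta> = \<alpha> then 1 else 0)"
    and G: "\<And>x. G x = (\<Sum>\<beta>\<in>mi_upto m. a \<beta> * of_real (mi_power x \<beta>)) + R x"
    and R: "integrable lborel (\<lambda>x. R x * \<psi> x)"
    and a: "\<alpha> \<notin> mi_upto m \<Longrightarrow> a \<alpha> = 0"
  shows "fun_distribution G \<psi> = a \<alpha> + fun_distribution R \<psi>"
proof -
  have "fun_distribution G \<psi>
      = (LINT x|lborel. (\<Sum>\<beta>\<in>mi_upto m. a \<beta> * (of_real (mi_power x \<beta>) * \<psi> x)) + R x * \<psi> x)"
    unfolding fun_distribution_def G by (simp add: algebra_simps sum_distrib_left sum_distrib_right)
  also have "\<dots> = (LINT x|lborel. (\<Sum>\<beta>\<in>mi_upto m. a \<beta> * (of_real (mi_power x \<beta>) * \<psi> x)))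
      + fun_distribution R \<psi>"
    unfolding fun_distribution_def
    by (intro Bochner_Integration.integral_add Bochner_Integration.integrable_sum integrable_mult_right \<psi> R)
  also have "(LINT x|lborel. (\<Sum>\<beta>\<in>mi_upto m. a \<beta> * (of_real (mi_power x \<beta>) * \<psi> x)))
      = (\<Sum>\<beta>\<in>mi_upto m. LINT x|lborel. a \<beta> * (of_real (mi_power x \<beta>) * \<psi> x))"
    by (intro Bochner_Integration.integral_sum integrable_mult_right \<psi>)
  also have "\<dots> = (\<Sum>\<beta>\<in>mi_upto m. if \<beta> = \<alpha> then a \<beta> else 0)"
    by (intro sum.cong refl) (simp add: \<psi>(2))
  also have "\<dots> = a \<alpha>"
    using a by (simp add: finite_mi_upto)
  finally show ?thesis .
qed

lemma bigo_powr_imp_smallo_1: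
  fixes h :: "real \<Rightarrow> complex"
  assumes h: "(\<lambda>t. norm (h t)) \<in> O[at_right 0](\<lambda>t. t powr r)" and "r > 0"
  shows "h \<in> o[at_right 0](\<lambda>_. 1)"
proof -
  have "((\<lambda>t :: real. t powr r) \<longlongrightarrow> 0) (at_right 0)"
    using \<open>r > 0\<close>
    by (auto intro!: tendsto_zero_powrI tendsto_ident_at eventually_at_right_less[THEN eventually_mono])
  hence "(\<lambda>t :: real. t powr r) \<in> o[at_right 0](\<lambda>_. 1)"
    by (intro smalloI_tendsto) auto
  from landau_o.big_small_trans[OF h this]
  have "((\<lambda>t. norm (h t)) \<longlongrightarrow> 0) (at_right 0)"
    using smalloD_tendsto by fastforce
  thus ?thesis
    by (intro smalloI_tendsto) (auto dest: tendsto_norm_zero_cancel)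
qed

theorem propositionC2:
  fixes f :: "(real ^ 'n::finite \<Rightarrow> complex) \<Rightarrow> complex"
    and \<Phi> :: "real ^ 'n \<Rightarrow> complex"
    and d :: nat
    and g :: "real \<Rightarrow> real ^ 'n \<Rightarrow> complex"
  assumes "tempered_distribution f"
    and "has_temperate_order f d"
    and "\<Phi> \<in> schwartz"
    and g_def: "\<And>t. g t = convolution (dilation \<Phi> t) f"
  shows "(\<forall>t>0. smooth (g t)) \<and>
    (\<forall>m::int. m \<ge> -1 \<longrightarrow>
       (\<forall>\<alpha>\<in>mi_upto m.
          seminorm_bigo (\<lambda>t. taylor_term (g t) \<alpha>) (real CARD('n) + real (mi_size \<alpha>) - real d)) \<and>
       seminorm_bigo (\<lambda>t. taylor_remainder (g t) m) (real CARD('n) + real_of_int m + 1 - real d)) \<and>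
    (\<forall>(m :: real \<Rightarrow> int) (c :: ('n \<Rightarrow> nat) \<Rightarrow> real \<Rightarrow> complex) (R :: real \<Rightarrow> real ^ 'n \<Rightarrow> complex).
       (\<forall>t>0. \<forall>\<alpha>. int (mi_size \<alpha>) > m t \<longrightarrow> c \<alpha> t = 0) \<longrightarrow>
       (\<forall>t>0. \<forall>x. g t x = (\<Sum>\<alpha>\<in>mi_upto (m t). c \<alpha> t * of_real (mi_power x \<alpha>)) + R t x) \<longrightarrow>
       seminorm_smallo_1 R \<longrightarrow>
       (\<forall>\<alpha>. (\<lambda>t. c \<alpha> t - mi_partial \<alpha> (g t) 0 / of_real (mi_fact \<alpha>)) \<in> o[at_right 0](\<lambda>_. 1)) \<and>
       (\<forall>\<alpha>. int (mi_size \<alpha>) > int d - int CARD('n) \<longrightarrow> c \<alpha> \<in> o[at_right 0](\<lambda>_. 1)))"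
proof -
  note \<Phi> = assms(3)
  obtain K0 where K0: "\<And>\<psi>. \<psi> \<in> schwartz \<Longrightarrow> norm (f \<psi>) \<le> K0 * schwartz_seminorm d \<psi>"
    using assms(2) unfolding has_temperate_order_def seminorm_bounded_def by blast
  \<comment> \<open>The constant in the order condition carries no sign, whereas the locale asks for
    a nonnegative one.\<close>
  define K where "K = \<bar>K0\<bar>"
  interpret schwartz_functional f d K
  proof
    show "norm (f \<psi>) \<le> K * schwartz_seminorm d \<psi>" if "\<psi> \<in> schwartz" for \<psi>
      using K0[OF that] mult_right_mono[OF abs_ge_self[of K0] schwartz_seminorm_nonneg[OF that, of d]]
      by (simp add: K_def)
  qed (use assms(1) in \<open>auto simp: tempered_distribution_def K_def\<close>)
  define n where "n = CARD('n)"
  define B where "B k t = K * (schwartz_seminorm (d + k) \<Phi> *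
      (t ^ (n + k) * max 1 (1 / t) ^ d * max 1 t ^ d))" for k and t :: real
  have smooth: "smooth (g t)" if "t > 0" for t
    unfolding g_def by (intro smooth_convolution schwartz_dilation \<Phi> that)
  have B: "norm (iter_partial is (g t) x) \<le> B (length is) t * (1 + norm x) ^ d" if "t > 0" for "is" t x
    unfolding B_def n_def g_def by (rule convolution_dilation_bound[OF \<Phi> that])
  have B_nonneg: "0 \<le> B k t" if "t > 0" for k t
    unfolding B_def using that schwartz_seminorm_nonneg[OF \<Phi>] c_nonneg
    by (intro mult_nonneg_nonneg) auto
  have B_eq: "B k t = (K * schwartz_seminorm (d + k) \<Phi>) * t powr (real n + real k - real d)"
    if "0 < t" "t \<le> 1" for k t
  proof -
    have "max 1 (1 / t) = 1 / t" "max 1 t = 1" using that by auto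
    hence "t ^ (n + k) * max 1 (1 / t) ^ d * max 1 t ^ d = t ^ (n + k) / t ^ d"
      by (simp add: divide_inverse power_inverse)
    also have "\<dots> = t powr (real n + real k - real d)"
      using that by (simp add: powr_diff powr_realpow flip: of_nat_add)
    finally show ?thesis by (simp add: B_def mult.assoc)
  qed
  have coeff: "norm (mi_partial \<alpha> (g t) 0) \<le> B (mi_size \<alpha>) t" if "t > 0" for t \<alpha>
    using B[OF that, of "mi_list \<alpha>" 0] by (simp add: mi_partial_eq_iter_partial length_mi_list)
  have taylor_terms: "seminorm_bigo (\<lambda>t. taylor_term (g t) \<alpha>) (real n + real (mi_size \<alpha>) - real d)" for \<alpha>
  proof (rule seminorm_bigo_growth[where K = "K * schwartz_seminorm (d + mi_size \<alpha>) \<Phi>"])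
    show "continuous_on UNIV (taylor_term (g t) \<alpha>)" for t
      unfolding taylor_term_def[abs_def]
      by (intro continuous_intros continuous_mi_power) (simp add: mi_fact_nonzero)
    show "norm (taylor_term (g t) \<alpha> x) \<le> B (mi_size \<alpha>) t * (1 + norm x) ^ mi_size \<alpha>" if "t > 0" for t x
      by (rule norm_taylor_term_le[OF coeff[OF that]])
  qed (simp add: B_eq)
  have remainder: "seminorm_bigo (\<lambda>t. taylor_remainder (g t) m) (real n + real_of_int m + 1 - real d)"
    if "m \<ge> -1" for m
  proof -
    \<comment> \<open>The lowest order of derivatives absent from P_m; it is 0 for m = -1.\<close>
    define k where "k = nat (m + 1)"
    have m: "m = int k - 1" using that by (simp add: k_def)
    have "seminorm_bigo (\<lambda>t. taylor_remainder (g t) (int k - 1)) (real n + real k - real d)"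
    proof (rule seminorm_bigo_growth[where K = "real n ^ k * (K * schwartz_seminorm (d + k) \<Phi>)"])
      show "continuous_on UNIV (taylor_remainder (g t) (int k - 1))" if "t > 0" for t
        unfolding taylor_remainder_def[abs_def]
        by (intro continuous_on_diff smooth_continuous smooth that
            differentiable_imp_continuous_on taylor_poly_derivative)
      show "norm (taylor_remainder (g t) (int k - 1) x) \<le> (real n ^ k * B k t) * (1 + norm x) ^ (k + d)"
        if "t > 0" for t x
      proof -
        have "norm (taylor_remainder (g t) (int k - 1) x)
            \<le> (real n ^ k * B k t) * norm x ^ k * (1 + norm x) ^ d"
          unfolding n_def
          by (rule taylor_remainder_bound) (use smooth B B_nonneg that in auto)
        also have "\<dots> \<le> (real n ^ k * B k t) * (1 + norm x) ^ k * (1 + norm x) ^ d"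
          using B_nonneg[OF that] by (intro mult_right_mono mult_left_mono power_mono) auto
        finally show ?thesis by (simp add: power_add mult.assoc)
      qed
    qed (simp add: B_eq mult.assoc)
    thus ?thesis by (simp add: m)
  qed
  have coefficients: "(\<lambda>t. c \<alpha> t - mi_partial \<alpha> (g t) 0 / of_real (mi_fact \<alpha>)) \<in> o[at_right 0](\<lambda>_. 1)"
    if c: "\<forall>t>0. \<forall>\<alpha>. int (mi_size \<alpha>) > m t \<longrightarrow> c \<alpha> t = 0"
      and g: "\<forall>t>0. \<forall>x. g t x = (\<Sum>\<alpha>\<in>mi_upto (m t). c \<alpha> t * of_real (mi_power x \<alpha>)) + R t x"
      and R: "seminorm_smallo_1 R"
    for m :: "real \<Rightarrow> int" and c :: "('n \<Rightarrow> nat) \<Rightarrow> real \<Rightarrow> complex" and R :: "real \<Rightarrow> real ^ 'n \<Rightarrow> complex" and \<alpha>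
  proof -
    obtain \<psi> :: "real ^ 'n \<Rightarrow> complex" where \<psi>: "\<psi> \<in> schwartz"
      "\<And>\<beta>. integrable lborel (\<lambda>x. of_real (mi_power x \<beta>) * \<psi> x)"
      "\<And>\<beta>. (LINT x|lborel. of_real (mi_power x \<beta>) * \<psi> x) = (if \<beta> = \<alpha> then 1 else 0)"
      using schwartz_dual_monomials by blast
    \<comment> \<open>Large enough that \<open>\<alpha>\<close> occurs in the Taylor polynomial of
      degree M and that the exponent n + M + 1 - d = n + |\<alpha>| + 1 of its remainder is
      positive.\<close>
    define M where "M = int (mi_size \<alpha> + d)"
    have T: "seminorm_bigo (\<lambda>t. taylor_remainder (g t) M) (real n + real_of_int M + 1 - real d)"
      by (rule remainder) (simp add: M_def)
    have "(\<lambda>t. norm (fun_distribution (taylor_remainder (g t) M) \<psi>))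
        \<in> O[at_right 0](\<lambda>t. t powr (real n + real_of_int M + 1 - real d))"
      using T \<psi>(1) by (simp add: seminorm_bigo_def distribution_bigo_def)
    hence 1: "(\<lambda>t. fun_distribution (taylor_remainder (g t) M) \<psi>) \<in> o[at_right 0](\<lambda>_. 1)"
      by (rule bigo_powr_imp_smallo_1) (simp add: M_def)
    have 2: "(\<lambda>t. fun_distribution (R t) \<psi>) \<in> o[at_right 0](\<lambda>_. 1)"
      using R \<psi>(1) by (simp add: seminorm_smallo_1_def distribution_smallo_1_def)
    \<comment> \<open>Both decompositions of g_t are paired with the same \<open>\<psi>\<close>;
      each yields its coefficient at \<open>\<alpha>\<close> plus the pairing with its own
      remainder.\<close>
    have eq: "c \<alpha> t - mi_partial \<alpha> (g t) 0 / of_real (mi_fact \<alpha>)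
        = fun_distribution (taylor_remainder (g t) M) \<psi> - fun_distribution (R t) \<psi>" if "t > 0" for t
    proof -
      have "fun_distribution (g t) \<psi> = c \<alpha> t + fun_distribution (R t) \<psi>"
      proof (rule fun_distribution_polynomial_part[OF \<psi>(2,3), where m = "m t"])
        show "integrable lborel (\<lambda>x. R t x * \<psi> x)"
          using R that \<psi>(1) by (simp add: seminorm_smallo_1_def pairs_with_schwartz_def)
      qed (use c g that in \<open>auto simp: mi_upto_def\<close>)
      moreover have "fun_distribution (g t) \<psi>
          = mi_partial \<alpha> (g t) 0 / of_real (mi_fact \<alpha>) + fun_distribution (taylor_remainder (g t) M) \<psi>"
      proof (rule fun_distribution_polynomial_part[OF \<psi>(2,3), where m = M])
        show "g t x = (\<Sum>\<beta>\<in>mi_upto M. mi_partial \<beta> (g t) 0 / of_real (mi_fact \<beta>) * of_real (mi_power x \<beta>))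
            + taylor_remainder (g t) M x" for x
          by (simp add: taylor_remainder_def taylor_poly_def taylor_term_def)
        show "integrable lborel (\<lambda>x. taylor_remainder (g t) M x * \<psi> x)"
          using T that \<psi>(1) by (simp add: seminorm_bigo_def pairs_with_schwartz_def)
        show "mi_partial \<alpha> (g t) 0 / of_real (mi_fact \<alpha>) = 0" if "\<alpha> \<notin> mi_upto M"
          using that by (simp add: mi_upto_def M_def)
      qed
      ultimately show ?thesis by (simp add: algebra_simps)
    qed
    have "\<forall>\<^sub>F t in at_right 0. c \<alpha> t - mi_partial \<alpha> (g t) 0 / of_real (mi_fact \<alpha>)
        = fun_distribution (taylor_remainder (g t) M) \<psi> - fun_distribution (R t) \<psi>"
      using eventually_at_right_less[of 0] by (rule eventually_mono) (rule eq)
    thus ?thesis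
      using sum_in_smallo(2)[OF 1 2] by (subst landau_o.small.in_cong)
  qed
  \<comment> \<open>The coefficient obeys the bound of its Taylor term, and the condition on
    \<open>\<alpha>\<close> says precisely that the exponent n + |\<alpha>| - d is positive.\<close>
  have taylor_coeff: "(\<lambda>t. mi_partial \<alpha> (g t) 0 / of_real (mi_fact \<alpha>)) \<in> o[at_right 0](\<lambda>_. 1)"
    if "int (mi_size \<alpha>) > int d - int CARD('n)" for \<alpha>
  proof (rule bigo_powr_imp_smallo_1)
    let ?r = "real n + real (mi_size \<alpha>) - real d"
    let ?C = "K * schwartz_seminorm (d + mi_size \<alpha>) \<Phi>"
    have "norm (mi_partial \<alpha> (g t) 0 / of_real (mi_fact \<alpha>)) \<le> ?C * norm (t powr ?r)" if "0 < t" "t < 1" for t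
    proof -
      have "norm (mi_partial \<alpha> (g t) 0 / of_real (mi_fact \<alpha>)) \<le> norm (mi_partial \<alpha> (g t) 0) / 1"
        unfolding norm_divide using mi_fact_ge_1[of \<alpha>] by (intro divide_left_mono) auto
      thus ?thesis using coeff[of t \<alpha>] B_eq[of t "mi_size \<alpha>"] that by simp
    qed
    thus "(\<lambda>t. norm (mi_partial \<alpha> (g t) 0 / of_real (mi_fact \<alpha>))) \<in> O[at_right 0](\<lambda>t. t powr ?r)"
      by (intro bigoI[of _ ?C]) (auto simp: eventually_at_right[OF zero_less_one] intro!: exI[of _ 1])
    show "?r > 0"
      using that by (simp add: n_def)
  qed
  have small: "c \<alpha> \<in> o[at_right 0](\<lambda>_. 1)"
    if "(\<lambda>t. c \<alpha> t - mi_partial \<alpha> (g t) 0 / of_real (mi_fact \<alpha>)) \<in> o[at_right 0](\<lambda>_. 1)"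
      "int (mi_size \<alpha>) > int d - int CARD('n)" for c :: "('n \<Rightarrow> nat) \<Rightarrow> real \<Rightarrow> complex" and \<alpha>
    using sum_in_smallo(1)[OF that(1) taylor_coeff[OF that(2)]] by simp
  show ?thesis
    unfolding n_def[symmetric]
    using smooth taylor_terms remainder coefficients small unfolding n_def by blast
qed

end
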